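(* Let $q=p^m$ be a prime power and let $G_{\rm RS}(q)$ be the $q$-ary Reed–Solomon matrix. Then any $q$-ary source is polarized by $G_{\rm RS}(q)$, and $$E_{\mathrm c}(G_{\rm RS}(q))=E_{\mathrm s}(G_{\rm RS}(q))=\frac{\log_q(q!)}{q}.$$
   Context: With $\alpha$ a primitive element of $\mathbb{F}_q$, the Reed–Solomon matrix $G_{\rm RS}(q)$ is the $q\times q$ matrix over $\mathbb{F}_q$ with rows and columns indexed by $0,\dots,q-1$, whose $(i,j)$ entry is $\alpha^{ij}$ for $0\le i\le q-1$, $0\le j\le q-2$, and whose last column ($j=q-1$) is $0$ in rows $0,\dots,q-2$ and $1$ in row $q-1$. For an invertible $\ell\times\ell$ matrix $G$ over $\mathbb{F}_q$ (indices from $0$): $E_{\mathrm c}(G):=\frac{1}{\ell\log\ell}\sum_{i=0}^{\ell-1}\log D_{\mathrm c}^{(i)}(G)$, where $D_{\mathrm c}^{(i)}(G)$ is the Hamming distance between the $i$-th row of $G$ and the linear span of rows $i+1,\dots,\ell-1$ of $G$ (zero space if $i=\ell-1$); $E_{\mathrm s}(G):=\frac{1}{\ell\log\ell}\sum_{i=0}^{\ell-1}\log D_{\mathrm s}^{(i)}(G)$, where $D_{\mathrm s}^{(i)}(G)$ is the Hamming distance between the $i$-th column of $G^{-1}$ and the linear span of columns $0,\dots,i-1$ of $G^{-1}$ (zero space if $i=0$). A $q$-ary source $(X,Y)$ is a pair of random variables on $\mathbb{F}_q\times\mathcal{Y}$, $\mathcal{Y}$ a discrete set; $H(X\mid Y)=-\sum_{x,y}P_{X,Y}(x,y)\log_q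 P_{X\mid Y}(x\mid y)$. Basic transform by $G$: let $(X_i,Y_i)$, $i=0,\dots,\ell-1$, be independent copies of $(X,Y)$, define $U_0^{\ell-1}=[U_0,\dots,U_{\ell-1}]$ by $X_0^{\ell-1}=U_0^{\ell-1}G$, and set $(X^{(i)},Y^{(i)}):=(U_i,(U_0^{i-1},Y_0^{\ell-1}))$. Recursively, $(X^{(b_1)\cdots(b_n)},Y^{(b_1)\cdots(b_n)})$ is the $b_n$-th output of the basic transform applied to $(X^{(b_1)\cdots(b_{n-1})},Y^{(b_1)\cdots(b_{n-1})})$. Let $B_1,B_2,\dots$ be i.i.d. uniform on $\{0,\dots,\ell-1\}$ and let $H_n$ be $H(X^{(b_1)\cdots(b_n)}\mid Y^{(b_1)\cdots(b_n)})$ evaluated at $(b_1,\dots,b_n)=(B_1,\dots,B_n)$. $(H_n)$ is a bounded martingale converging a.s. to some $H_\infty$. $(X,Y)$ is polarized by $G$ iff $H_\infty=0$ with probability $1-H(X\mid Y)$ and $H_\infty=1$ with probability $H(X\mid Y)$. *)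

theory Defs
  imports
    "HOL-Probability.Probability"
    "HOL-Computational_Algebra.Primes"
    "Jordan_Normal_Form.VS_Connect"
    "Jordan_Normal_Form.Gauss_Jordan_Elimination"
begin

section \<open>Reed--Solomon matrices\<close>

definition primitive_element :: "'a::{field,finite} \<Rightarrow> bool" where
  "primitive_element \<alpha> \<longleftrightarrow> \<alpha> \<noteq> 0 \<and> (\<forall>x. x \<noteq> 0 \<longrightarrow> (\<exists>k::nat. x = \<alpha> ^ k))"

definition rs_mat :: "'a::{field,finite} \<Rightarrow> 'a mat" where
  "rs_mat \<alpha> = mat CARD('a) CARD('a)
     (\<lambda>(i, j). if j < CARD('a) - 1 then \<alpha> ^ (i * j)
               else if i = CARD('a) - 1 then 1 else 0)"


section \<open>Exponents of a matrix\<close>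

definition hamming :: "'a vec \<Rightarrow> 'a vec \<Rightarrow> nat" where
  "hamming v w = card {j. j < dim_vec v \<and> v $ j \<noteq> w $ j}"

definition hamming_set :: "'a vec \<Rightarrow> 'a vec set \<Rightarrow> nat" where
  "hamming_set v S = (INF w\<in>S. hamming v w)"

definition vec_span :: "nat \<Rightarrow> 'a::field vec set \<Rightarrow> 'a vec set" where
  "vec_span n S = LinearCombinations.module.span class_ring (module_vec TYPE('a) n) S"

text \<open>Only meaningful for invertible matrices; otherwise the value is unspecified.\<close>

definition inv_mat :: "'a::field mat \<Rightarrow> 'a mat" where
  "inv_mat G = the (mat_inverse G)"

definition Dc :: "'a::field mat \<Rightarrow> nat \<Rightarrow> nat" where
  "Dc G i = hamming_set (row G i) (vec_span (dim_row G) (row G ` {i<..<dim_row G}))"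

definition Ds :: "'a::field mat \<Rightarrow> nat \<Rightarrow> nat" where
  "Ds G i = hamming_set (col (inv_mat G) i) (vec_span (dim_row G) (col (inv_mat G) ` {..<i}))"

text \<open>Both exponents are quotients of logarithms, so the base is immaterial; we use \<open>ln\<close>.\<close>

definition Ec :: "'a::field mat \<Rightarrow> real" where
  "Ec G = 1 / (real (dim_row G) * ln (real (dim_row G))) * (\<Sum>i<dim_row G. ln (real (Dc G i)))"

definition Es :: "'a::field mat \<Rightarrow> real" where
  "Es G = 1 / (real (dim_row G) * ln (real (dim_row G))) * (\<Sum>i<dim_row G. ln (real (Ds G i)))"


section \<open>Sources and the polar transform\<close>

text \<open>
  A source is represented by the joint law of \<open>(X, Y)\<close>. The alphabet of \<open>Y\<close> is an arbitrary
  type; a discrete law has countable support.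
\<close>

type_synonym ('a, 'y) source = "('a \<times> 'y) pmf"

text \<open>
  Pairs of probability zero contribute \<open>0\<close>. The conditional probability of \<open>x\<close> given \<open>y\<close> is the
  quotient of the joint and the marginal mass, and logarithms are taken to base \<open>q = CARD('a)\<close>.
\<close>

definition cond_entropy :: "('a::finite, 'y) source \<Rightarrow> real" where
  "cond_entropy P = - (\<Sum>\<^sub>\<infinity>(x, y)\<in>UNIV.
     pmf P (x, y) * log (real CARD('a)) (pmf P (x, y) / pmf (map_pmf snd P) y))"

text \<open>
  The alphabet of the second component changes with every basic transform. To iterate the
  transform, all these alphabets are embedded into one type: \<open>Orig y\<close> is an original observation,
  and \<open>Trans us ys\<close> is the pair of \<open>U_0, \<dots>, U_{i-1}\<close> and \<open>Y_0, \<dots>, Y_{\<ell>-1}\<close>.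
\<close>

datatype ('a, 'y) obs = Orig 'y | Trans "'a list" "('a, 'y) obs list"

definition basic_transform ::
  "'a::field mat \<Rightarrow> nat \<Rightarrow> ('a, ('a, 'y) obs) source \<Rightarrow> ('a, ('a, 'y) obs) source" where
  "basic_transform G i P = map_pmf
     (\<lambda>xys. let x = vec_of_list (map fst xys);
                u = (THE u. u \<in> carrier_vec (dim_row G) \<and> x = transpose_mat G *\<^sub>v u)
            in (u $ i, Trans (map (\<lambda>j. u $ j) [0..<i]) (map snd xys)))
     (replicate_pmf (dim_row G) P)"

text \<open>The source obtained along the path \<open>bs\<close>; the head of the list is applied first.\<close>

definition path_source ::
  "'a::field mat \<Rightarrow> ('a, 'y) source \<Rightarrow> nat list \<Rightarrow> ('a, ('a, 'y) obs) source" where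
  "path_source G P bs = fold (basic_transform G) bs (map_pmf (\<lambda>(x, y). (x, Orig y)) P)"

text \<open>
  The canonical space of an i.i.d. sequence that is uniform on \<open>{0, \<dots>, \<ell> - 1}\<close>, with \<open>B_n\<close>
  given by the coordinate \<open>\<omega> (n - 1)\<close>.
\<close>

definition index_space :: "nat \<Rightarrow> (nat \<Rightarrow> nat) measure" where
  "index_space l = PiM UNIV (\<lambda>_::nat. measure_pmf (pmf_of_set {..<l}))"

definition entropy_process ::
  "'a::{field,finite} mat \<Rightarrow> ('a, 'y) source \<Rightarrow> nat \<Rightarrow> (nat \<Rightarrow> nat) \<Rightarrow> real" where
  "entropy_process G P n \<omega> = cond_entropy (path_source G P (map \<omega> [0..<n]))"

text \<open>The limit is unique up to null sets, so the choice of \<open>Hinf\<close> does not matter.\<close>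

definition polarized_by :: "'a::{field,finite} mat \<Rightarrow> ('a, 'y) source \<Rightarrow> bool" where
  "polarized_by G P \<longleftrightarrow>
     (\<exists>Hinf \<in> borel_measurable (index_space (dim_row G)).
        (AE \<omega> in index_space (dim_row G). (\<lambda>n. entropy_process G P n \<omega>) \<longlonglongrightarrow> Hinf \<omega>) \<and>
        measure (index_space (dim_row G)) {\<omega> \<in> space (index_space (dim_row G)). Hinf \<omega> = 0}
          = 1 - cond_entropy P \<and>
        measure (index_space (dim_row G)) {\<omega> \<in> space (index_space (dim_row G)). Hinf \<omega> = 1}
          = cond_entropy P)"

end

theory Submission
  imports Defs "HOL-Real_Asymp.Real_Asymp"
begin

text \<open>
  A combination of the rows \<open>k, \<dots>, q - 1\<close> of the Reed--Solomon matrix is the evaluation of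
  \<open>x\<^sup>k f(x)\<close> with \<open>deg f \<le> q - 1 - k\<close> at the nonzero points, followed by the leading coefficient as
  the value at infinity. So it has at most \<open>q - 1 - k\<close> zeros, and these can be prescribed; with
  duality for the inverse matrix this makes both families of partial distances equal to
  \<open>{1, \<dots>, q}\<close>.

  For polarization, let \<open>V\<close> be the mean square of the one-step increments of \<open>H\<^sub>n\<close>. Since the second
  moment grows by the expectation of \<open>V\<close> in each step, \<open>\<Sum> V\<close> has finite expectation, so \<open>V \<rightarrow> 0\<close>
  almost surely. It remains to see that \<open>H(1 - H)\<close> is small whenever all increments are small.
  Conditioned on the observations the inputs are independent, and submodularity of entropy
  bounds the entropy of the last one or two messages: small increments force
  \<open>H(X\<^sub>0 - \<beta> X\<^sub>1 | Y)\<close> to be close to \<open>H(X | Y)\<close> for \<open>\<beta> = 1\<close> and \<open>\<beta> = \<alpha>\<close>. If, for laws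
  \<open>P\<close> and \<open>Q\<close> of the input, subtracting an independent \<open>\<alpha>\<close>-multiple of a \<open>Q\<close>-variable does not
  increase the entropy of \<open>P\<close>, and subtracting a \<open>P\<close>-variable does not increase that of \<open>Q\<close>, then
  \<open>P\<close> is deterministic or \<open>Q\<close> is uniform, as \<open>\<alpha>\<close> is primitive. Compactness of the probability simplex makes
  this uniform, and averaging over two independent observations bounds \<open>H(1 - H)\<close>.
\<close>

unbundle no vec_syntax

section \<open>Reed--Solomon matrices\<close>

text \<open>The image set is replaced by the list \<open>ws\<close>, whose linear combinations are
  matrix-vector products. With a list the coefficients stay indexed by \<open>i\<close>, even if
  \<open>f\<close> is not injective.\<close>

lemma vec_span_image:
  fixes f :: "nat \<Rightarrow> 'a::field vec"
  assumes f: "\<And>i. i \<in> {a..<b} \<Longrightarrow> f i \<in> carrier_vec n"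
  shows "vec_span n (f ` {a..<b}) = {vec n (\<lambda>j. \<Sum>i=a..<b. c i * f i $ j) | c. True}"
proof -
  interpret vec_space "TYPE('a)" n .
  define ws where "ws = map f [a..<b]"
  have ws: "set ws \<subseteq> carrier_vec n" and dim: "\<forall>w\<in>set ws. dim_vec w = n"
    and img: "f ` {a..<b} = set ws"
    using f by (auto simp: ws_def)
  have mv: "mat_of_cols n ws *\<^sub>v vec (length ws) d
      = vec n (\<lambda>j. \<Sum>i=a..<b. d (i - a) * f i $ j)" for d :: "nat \<Rightarrow> 'a"
  proof (rule eq_vecI)
    fix j assume "j < dim_vec (vec n (\<lambda>j. \<Sum>i=a..<b. d (i - a) * f i $ j))"
    then have j: "j < n" by simp
    have "(mat_of_cols n ws *\<^sub>v vec (length ws) d) $ j = (\<Sum>r<b - a. d r * f (a + r) $ j)"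
      using j by (simp add: scalar_prod_def mat_of_cols_index ws_def atLeast0LessThan mult.commute)
    also have "\<dots> = (\<Sum>i=a..<b. d (i - a) * f i $ j)"
      by (rule sum.reindex_bij_witness[of _ "\<lambda>i. i - a" "\<lambda>r. a + r"]) auto
    finally show "(mat_of_cols n ws *\<^sub>v vec (length ws) d) $ j
        = vec n (\<lambda>j. \<Sum>i=a..<b. d (i - a) * f i $ j) $ j"
      using j by simp
  qed (simp add: ws_def)
  have "vec_span n (f ` {a..<b}) = span_list ws"
    unfolding vec_span_def img span_list_as_span[OF ws] ..
  also have "\<dots> = {mat_of_cols n ws *\<^sub>v vec (length ws) d | d. True}"
    by (auto simp: span_list_def lincomb_list_as_mat_mult[OF dim])
  also have "\<dots> = {vec n (\<lambda>j. \<Sum>i=a..<b. c i * f i $ j) | c. True}"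
  proof (intro equalityI subsetI)
    fix w assume "w \<in> {mat_of_cols n ws *\<^sub>v vec (length ws) d | d. True}"
    then obtain d where "w = mat_of_cols n ws *\<^sub>v vec (length ws) d" by blast
    then have "w = vec n (\<lambda>j. \<Sum>i=a..<b. (\<lambda>i. d (i - a)) i * f i $ j)" by (simp only: mv)
    then show "w \<in> {vec n (\<lambda>j. \<Sum>i=a..<b. c i * f i $ j) | c. True}"
      by (intro CollectI exI[of _ "\<lambda>i. d (i - a)"]) simp
  next
    fix w assume "w \<in> {vec n (\<lambda>j. \<Sum>i=a..<b. c i * f i $ j) | c. True}"
    then obtain c where "w = vec n (\<lambda>j. \<Sum>i=a..<b. c i * f i $ j)" by blast
    then have "w = mat_of_cols n ws *\<^sub>v vec (length ws) (\<lambda>r. c (a + r))" by (simp add: mv)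
    then show "w \<in> {mat_of_cols n ws *\<^sub>v vec (length ws) d | d. True}" by blast
  qed
  finally show ?thesis .
qed

section \<open>Powers of a primitive element\<close>

lemma card_field_ge_2: "CARD('a::{field,finite}) \<ge> 2"
proof -
  have "card {0, 1::'a} \<le> CARD('a)" by (rule card_mono) auto
  then show ?thesis by simp
qed

text \<open>Below the least period \<open>N\<close> all powers of \<alpha> are distinct, and
  reducing exponents modulo \<open>N\<close> shows that they exhaust the nonzero elements. Counting
  gives \<open>N = CARD('a) - 1\<close>.\<close>

lemma primitive_element_order:
  fixes \<alpha> :: "'a::{field,finite}"
  assumes "primitive_element \<alpha>"
  shows primitive_element_inj: "inj_on (\<lambda>k. \<alpha> ^ k) {..<CARD('a) - 1}"
    and primitive_element_power: "\<alpha> ^ (CARD('a) - 1) = 1"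
proof -
  have nz: "\<alpha> \<noteq> 0" and gen: "\<And>x. x \<noteq> 0 \<Longrightarrow> \<exists>k::nat. x = \<alpha> ^ k"
    using assms by (auto simp: primitive_element_def)
  have sub1: "\<alpha> ^ (j - i) = 1" if "i \<le> j" "\<alpha> ^ i = \<alpha> ^ j" for i j :: nat
    using that nz by (simp add: power_diff)
  have "\<not> inj (\<lambda>k::nat. \<alpha> ^ k)"
    using finite_imageD[of "\<lambda>k::nat. \<alpha> ^ k" UNIV] by auto
  then obtain i j :: nat where "i < j" "\<alpha> ^ i = \<alpha> ^ j"
    unfolding inj_def by (metis nat_neq_iff)
  then have ex: "\<exists>n>0. \<alpha> ^ n = 1" using sub1[of i j] by (intro exI[of _ "j - i"]) auto
  define N where "N = (LEAST n. n > 0 \<and> \<alpha> ^ n = 1)"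
  have N: "N > 0" "\<alpha> ^ N = 1" using LeastI_ex[OF ex] by (auto simp: N_def)
  have least: "\<not> (n > 0 \<and> \<alpha> ^ n = 1)" if "n < N" for n
    using not_less_Least[of n] that unfolding N_def by blast
  have inj: "inj_on (\<lambda>k. \<alpha> ^ k) {..<N}"
  proof (rule linorder_inj_onI')
    fix i j assume "i \<in> {..<N}" "j \<in> {..<N}" "i < j"
    then show "\<alpha> ^ i \<noteq> \<alpha> ^ j" using sub1[of i j] least[of "j - i"] by auto
  qed
  have "(\<lambda>k. \<alpha> ^ k) ` {..<N} = UNIV - {0}"
  proof (intro equalityI subsetI)
    fix x assume "x \<in> UNIV - {0::'a}"
    then obtain k where k: "x = \<alpha> ^ k" using gen by blast
    have "\<alpha> ^ k = \<alpha> ^ (N * (k div N) + k mod N)" by simp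
    also have "\<dots> = \<alpha> ^ (k mod N)" by (simp only: power_add power_mult N power_one mult_1_left)
    finally show "x \<in> (\<lambda>k. \<alpha> ^ k) ` {..<N}" using k N by auto
  qed (use nz in auto)
  then have "N = CARD('a) - 1" using card_image[OF inj] by simp
  then show "inj_on (\<lambda>k. \<alpha> ^ k) {..<CARD('a) - 1}" "\<alpha> ^ (CARD('a) - 1) = 1"
    using inj N by auto
qed

section \<open>Row combinations as polynomial evaluations\<close>

lemma rs_mat_carrier [simp]:
  "rs_mat (\<alpha> :: 'a::{field,finite}) \<in> carrier_mat CARD('a) CARD('a)"
  "dim_row (rs_mat \<alpha>) = CARD('a)" "dim_col (rs_mat \<alpha>) = CARD('a)"
  by (auto simp: rs_mat_def)

lemma rs_mat_index:
  fixes \<alpha> :: "'a::{field,finite}"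
  assumes "i < CARD('a)" "j < CARD('a)"
  shows "rs_mat \<alpha> $$ (i, j)
    = (if j < CARD('a) - 1 then \<alpha> ^ (i * j) else if i = CARD('a) - 1 then 1 else 0)"
  using assms by (simp add: rs_mat_def)

lemma rs_mat_last_row:
  fixes \<alpha> :: "'a::{field,finite}"
  assumes "primitive_element \<alpha>" "j < CARD('a)"
  shows "rs_mat \<alpha> $$ (CARD('a) - 1, j) = 1"
  using assms primitive_element_power[OF assms(1)] by (simp add: rs_mat_index power_mult)

text \<open>The last column reads off the coefficient of the highest possible degree, that is, the
  value at infinity.\<close>

lemma rs_mat_last_col:
  fixes \<alpha> :: "'a::{field,finite}" and c :: "nat \<Rightarrow> 'a"
  assumes "k < CARD('a)"
  shows "(\<Sum>i=k..<CARD('a). c i * rs_mat \<alpha> $$ (i, CARD('a) - 1)) = c (CARD('a) - 1)"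
proof -
  have "(\<Sum>i=k..<CARD('a). c i * rs_mat \<alpha> $$ (i, CARD('a) - 1))
    = (\<Sum>i=k..<CARD('a). if i = CARD('a) - 1 then c i else 0)"
    by (rule sum.cong) (auto simp: rs_mat_index)
  then show ?thesis using assms by auto
qed

text \<open>Row \<open>i\<close> evaluates the monomial of degree \<open>i\<close> at the points
  \<open>\<alpha> ^ j\<close>. Starting at row \<open>k\<close> splits off the factor
  \<open>(\<alpha> ^ j) ^ k\<close>, which has no zeros for primitive \<alpha>.\<close>

lemma rs_mat_eval:
  fixes \<alpha> :: "'a::{field,finite}" and p :: "'a poly"
  assumes "k < CARD('a)" "degree p \<le> CARD('a) - 1 - k" "j < CARD('a) - 1"
  shows "(\<Sum>i=k..<CARD('a). coeff p (i - k) * rs_mat \<alpha> $$ (i, j)) = (\<alpha> ^ j) ^ k * poly p (\<alpha> ^ j)"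
proof -
  have "(\<Sum>i=k..<CARD('a). coeff p (i - k) * rs_mat \<alpha> $$ (i, j))
    = (\<Sum>i=k..<CARD('a). coeff p (i - k) * (\<alpha> ^ j) ^ i)"
    using assms by (intro sum.cong) (auto simp: rs_mat_index mult.commute power_mult[symmetric])
  also have "\<dots> = (\<Sum>r\<le>CARD('a) - 1 - k. (\<alpha> ^ j) ^ k * (coeff p r * (\<alpha> ^ j) ^ r))"
    using assms by (intro sum.reindex_bij_witness[of _ "\<lambda>r. r + k" "\<lambda>i. i - k"])
      (auto simp: power_add[symmetric] algebra_simps)
  also have "\<dots> = (\<alpha> ^ j) ^ k * poly p (\<alpha> ^ j)"
    unfolding poly_altdef sum_distrib_left
    using assms by (intro sum.mono_neutral_right) (auto simp: coeff_eq_0)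
  finally show ?thesis .
qed

text \<open>The points \<open>\<alpha> ^ j\<close> are distinct, so the zeros before the last column
  are bounded by the degree of the polynomial. A zero in the last column kills the top coefficient,
  and the drop in degree pays for the additional zero.\<close>

lemma rs_mat_card_zeros:
  fixes \<alpha> :: "'a::{field,finite}" and c :: "nat \<Rightarrow> 'a"
  assumes prim: "primitive_element \<alpha>" and ex: "\<exists>i\<in>{k..<CARD('a)}. c i \<noteq> 0"
  shows "card {j. j < CARD('a) \<and> (\<Sum>i=k..<CARD('a). c i * rs_mat \<alpha> $$ (i, j)) = 0} \<le> CARD('a) - 1 - k"
    (is "card ?Z \<le> _")
proof -
  let ?q = "CARD('a)"
  have k: "k < ?q" using ex by auto
  define p where "p = (\<Sum>r\<le>?q - 1 - k. monom (c (k + r)) r)"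
  have coeff_p: "coeff p r = (if r \<le> ?q - 1 - k then c (k + r) else 0)" for r
    by (simp add: p_def coeff_sum)
  have p0: "p \<noteq> 0"
  proof
    assume "p = 0"
    obtain i where i: "i \<in> {k..<?q}" "c i \<noteq> 0" using ex by blast
    then have "coeff p (i - k) = c i" by (auto simp: coeff_p)
    then show False using i \<open>p = 0\<close> by simp
  qed
  have deg: "degree p \<le> ?q - 1 - k" by (rule degree_le) (simp add: coeff_p)
  have ev: "(\<Sum>i=k..<?q. c i * rs_mat \<alpha> $$ (i, j)) = (\<alpha> ^ j) ^ k * poly p (\<alpha> ^ j)" if "j < ?q - 1" for j
    unfolding rs_mat_eval[OF k deg that, symmetric] by (rule sum.cong) (auto simp: coeff_p)
  have nz: "\<alpha> \<noteq> 0" using prim by (simp add: primitive_element_def)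
  define Z' where "Z' = ?Z \<inter> {..<?q - 1}"
  have "card Z' = card ((\<lambda>j. \<alpha> ^ j) ` Z')"
    by (rule card_image[symmetric], rule inj_on_subset[OF primitive_element_inj[OF prim]])
      (auto simp: Z'_def)
  also have "\<dots> \<le> card {x. poly p x = 0}"
    by (rule card_mono) (use nz in \<open>auto simp: Z'_def ev\<close>)
  also have "\<dots> \<le> degree p" by (rule card_poly_roots_bound[OF p0])
  finally have Z': "card Z' \<le> degree p" .
  show ?thesis
  proof (cases "?q - 1 \<in> ?Z")
    case False
    then have "?Z \<subseteq> {..<?q - 1}" by (metis (mono_tags, lifting) Suc_pred' lessThan_iff less_Suc_eq mem_Collect_eq subsetI zero_less_card_finite)
    then have "?Z = Z'" unfolding Z'_def by blast
    then show ?thesis using Z' deg by simp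
  next
    case True
    then have c0: "c (?q - 1) = 0" using rs_mat_last_col[OF k] by auto
    have "coeff p (?q - 1 - k) = 0" using c0 k by (simp add: coeff_p)
    then have "degree p \<noteq> ?q - 1 - k" using p0 by (metis leading_coeff_0_iff)
    then have "degree p < ?q - 1 - k" using deg by simp
    have "?Z = insert (?q - 1) Z'" using True by (auto simp: Z'_def)
    moreover have "?q - 1 \<notin> Z'" "finite Z'" by (auto simp: Z'_def)
    ultimately have "card ?Z = Suc (card Z')" by simp
    then show ?thesis using Z' \<open>degree p < ?q - 1 - k\<close> by simp
  qed
qed

text \<open>The polynomial is the product of the linear factors at the prescribed points. Its
  constant coefficient is a product of nonzero elements, hence \<open>c k \<noteq> 0\<close>. If the
  last column is prescribed, it uses up no factor, so the degree stays below the maximum and the top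
  coefficient is 0.\<close>

lemma rs_mat_annihilate:
  fixes \<alpha> :: "'a::{field,finite}"
  assumes prim: "primitive_element \<alpha>" and k: "k < CARD('a)"
    and T: "T \<subseteq> {..<CARD('a)}" "card T \<le> CARD('a) - 1 - k"
  shows "\<exists>c. c k \<noteq> 0 \<and> (\<forall>j\<in>T. (\<Sum>i=k..<CARD('a). c i * rs_mat \<alpha> $$ (i, j)) = 0)"
proof -
  let ?q = "CARD('a)"
  define T' where "T' = T - {?q - 1}"
  define p where "p = (\<Prod>t\<in>T'. [:- (\<alpha> ^ t), 1:])"
  have finT: "finite T" using T finite_subset by blast
  then have finT': "finite T'" by (simp add: T'_def)
  have deg: "degree p = card T'"
    unfolding p_def by (subst degree_prod_eq_sum_degree) auto
  have "card T' \<le> card T" using finT by (simp add: T'_def card_Diff1_le)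
  then have deg_le: "degree p \<le> ?q - 1 - k" using deg T by simp
  have nz: "\<alpha> \<noteq> 0" using prim by (simp add: primitive_element_def)
  have "coeff p 0 = (\<Prod>t\<in>T'. - (\<alpha> ^ t))"
    by (simp add: poly_0_coeff_0[symmetric] p_def poly_prod)
  also have "\<dots> \<noteq> 0" using nz finT' by simp
  finally have nz0: "coeff p (k - k) \<noteq> 0" by simp
  have "(\<Sum>i=k..<?q. coeff p (i - k) * rs_mat \<alpha> $$ (i, j)) = 0" if j: "j \<in> T" for j
  proof (cases "j = ?q - 1")
    case False
    then have jq: "j < ?q - 1" using subsetD[OF T(1) j] by simp
    moreover have "poly p (\<alpha> ^ j) = 0" using j False finT' by (auto simp: p_def poly_prod T'_def)
    ultimately show ?thesis using rs_mat_eval[OF k deg_le jq, of \<alpha>] by simp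
  next
    case True
    then have "card T' < card T" unfolding T'_def using j by (intro card_Diff1_less[OF finT]) auto
    then have "coeff p (?q - 1 - k) = 0" using deg T by (intro coeff_eq_0) simp
    then show ?thesis using rs_mat_last_col[OF k, of "\<lambda>i. coeff p (i - k)"] True by simp
  qed
  with nz0 show ?thesis by (intro exI[of _ "\<lambda>i. coeff p (i - k)"]) auto
qed

text \<open>A kernel vector of the transpose would be a nontrivial combination of all rows that
  vanishes in all \<open>CARD('a)\<close> columns, one more than the bound on zeros permits.\<close>

lemma det_rs_mat:
  fixes \<alpha> :: "'a::{field,finite}"
  assumes prim: "primitive_element \<alpha>"
  shows "det (rs_mat \<alpha>) \<noteq> 0"
proof
  let ?q = "CARD('a)"
  assume "det (rs_mat \<alpha>) = 0"
  then have "det (transpose_mat (rs_mat \<alpha>)) = 0" by (simp add: det_transpose[of _ ?q])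
  then obtain v where v: "v \<in> carrier_vec ?q" "v \<noteq> 0\<^sub>v ?q" "transpose_mat (rs_mat \<alpha>) *\<^sub>v v = 0\<^sub>v ?q"
    using det_0_iff_vec_prod_zero[of "transpose_mat (rs_mat \<alpha>)" ?q] by auto
  have "\<exists>i\<in>{0..<?q}. v $ i \<noteq> 0"
  proof (rule ccontr)
    assume "\<not> ?thesis"
    then have "v = 0\<^sub>v ?q" using v(1) by (intro eq_vecI) auto
    then show False using v(2) by simp
  qed
  note card = rs_mat_card_zeros[OF prim this]
  have "(\<Sum>i=0..<?q. v $ i * rs_mat \<alpha> $$ (i, j)) = 0" if "j < ?q" for j
  proof -
    have "(transpose_mat (rs_mat \<alpha>) *\<^sub>v v) $ j = (\<Sum>i=0..<?q. v $ i * rs_mat \<alpha> $$ (i, j))"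
      using that v(1) by (auto simp: scalar_prod_def mult.commute intro!: sum.cong)
    then show ?thesis using v(3) that by simp
  qed
  then have "{j. j < ?q \<and> (\<Sum>i=0..<?q. v $ i * rs_mat \<alpha> $$ (i, j)) = 0} = {..<?q}" by auto
  then show False using card card_field_ge_2[where 'a = 'a] by simp
qed

section \<open>Partial distances and exponents\<close>

lemma inv_mat:
  fixes G :: "'a::field mat"
  assumes G: "G \<in> carrier_mat n n" and det: "det G \<noteq> 0"
  shows "inv_mat G \<in> carrier_mat n n" "G * inv_mat G = 1\<^sub>m n" "inv_mat G * G = 1\<^sub>m n"
proof -
  have "G \<in> Units (ring_mat TYPE('a) n ())" by (rule det_non_zero_imp_unit[OF G det])
  then obtain B where B: "mat_inverse G = Some B"
    using mat_inverse(1)[OF G] by fastforce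
  then show "inv_mat G \<in> carrier_mat n n" "G * inv_mat G = 1\<^sub>m n" "inv_mat G * G = 1\<^sub>m n"
    using mat_inverse(2)[OF G B] by (simp_all add: inv_mat_def)
qed

lemma hamming_set_eqI:
  assumes "\<exists>w\<in>S. hamming v w \<le> d" "\<And>w. w \<in> S \<Longrightarrow> d \<le> hamming v w"
  shows "hamming_set v S = d"
proof (rule antisym)
  obtain w where w: "w \<in> S" "hamming v w \<le> d" using assms(1) by blast
  have "(INF w\<in>S. hamming v w) \<le> hamming v w" by (rule cINF_lower[OF _ w(1)]) simp
  then show "hamming_set v S \<le> d" using w(2) by (simp add: hamming_set_def)
  show "d \<le> hamming_set v S"
    unfolding hamming_set_def using w(1) assms(2) by (intro cINF_greatest) auto
qed

text \<open>Row \<open>i\<close> minus an element of the span is a combination of the rows from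
  \<open>i\<close> on with coefficient 1 at \<open>i\<close>. It has at most
  \<open>CARD('a) - 1 - i\<close> zeros, and annihilating the first \<open>CARD('a) - 1 - i\<close>
  columns attains this number.\<close>

lemma Dc_rs_mat:
  fixes \<alpha> :: "'a::{field,finite}"
  assumes prim: "primitive_element \<alpha>" and i: "i < CARD('a)"
  shows "Dc (rs_mat \<alpha>) i = Suc i"
proof -
  let ?q = "CARD('a)" and ?G = "rs_mat \<alpha>"
  let ?w = "\<lambda>c. vec ?q (\<lambda>j. \<Sum>k=Suc i..<?q. c k * row ?G k $ j)"
  have set: "{i<..<?q} = {Suc i..<?q}" by auto
  have span: "vec_span ?q (row ?G ` {i<..<?q}) = {?w c | c. True}"
    unfolding set by (rule vec_span_image, rule row_carrier_vec[OF _ rs_mat_carrier(1)]) simp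
  have ham: "hamming (row ?G i) (?w c)
      = ?q - card {j. j < ?q \<and> (\<Sum>k=i..<?q. (if k = i then 1 else - c k) * ?G $$ (k, j)) = 0}" for c
  proof -
    have eq: "(\<Sum>k=i..<?q. (if k = i then 1 else - c k) * ?G $$ (k, j)) = row ?G i $ j - ?w c $ j"
      if "j < ?q" for j
    proof -
      have "(\<Sum>k=i..<?q. (if k = i then 1 else - c k) * ?G $$ (k, j))
        = ?G $$ (i, j) + (\<Sum>k=Suc i..<?q. - (c k * ?G $$ (k, j)))"
        using i by (subst sum.atLeast_Suc_lessThan) auto
      then show ?thesis using that i by (simp add: sum_negf)
    qed
    have "{j. j < dim_vec (row ?G i) \<and> row ?G i $ j \<noteq> ?w c $ j}
      = {..<?q} - {j. j < ?q \<and> (\<Sum>k=i..<?q. (if k = i then 1 else - c k) * ?G $$ (k, j)) = 0}"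
      using eq rs_mat_carrier(3)[of \<alpha>] by (auto simp del: index_vec)
    then show ?thesis unfolding hamming_def by (simp add: card_Diff_subset subset_eq)
  qed
  show ?thesis
    unfolding Dc_def rs_mat_carrier span
  proof (rule hamming_set_eqI)
    fix w assume "w \<in> {?w c | c. True}"
    then obtain c where w: "w = ?w c" by blast
    have "\<exists>k\<in>{i..<?q}. (if k = i then 1 else - c k) \<noteq> 0"
      using i by (intro bexI[of _ i]) auto
    from rs_mat_card_zeros[OF prim this] show "Suc i \<le> hamming (row ?G i) w"
      using i unfolding w ham by simp
  next
    obtain c where c: "c i \<noteq> 0" "\<And>j. j < ?q - 1 - i \<Longrightarrow> (\<Sum>k=i..<?q. c k * ?G $$ (k, j)) = 0"
      using rs_mat_annihilate[OF prim i, of "{..<?q - 1 - i}"] by auto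
    \<comment> \<open>Division by \<open>c i\<close> normalises the coefficient of row
      \<open>i\<close> to 1.\<close>
    define d where "d k = - (c k / c i)" for k
    have zero: "(\<Sum>k=i..<?q. (if k = i then 1 else - d k) * ?G $$ (k, j)) = 0" if "j < ?q - 1 - i" for j
    proof -
      have "(\<Sum>k=i..<?q. (if k = i then 1 else - d k) * ?G $$ (k, j))
        = (\<Sum>k=i..<?q. c k * ?G $$ (k, j)) / c i"
        using c(1) by (auto simp: d_def sum_divide_distrib intro!: sum.cong)
      then show ?thesis using c(2)[OF that] by simp
    qed
    have "?q - 1 - i = card {..<?q - 1 - i}" by simp
    also have "\<dots> \<le> card {j. j < ?q \<and> (\<Sum>k=i..<?q. (if k = i then 1 else - d k) * ?G $$ (k, j)) = 0}"
      using zero by (intro card_mono) auto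
    finally have "hamming (row ?G i) (?w d) \<le> Suc i"
      using i unfolding ham by simp
    then show "\<exists>w\<in>{?w c | c. True}. hamming (row ?G i) w \<le> Suc i" by blast
  qed
qed

text \<open>Supplies the closest vector in the computation of \<open>Ds\<close>. The block
  \<open>M\<close> of the rows from \<open>i\<close> on and the first \<open>CARD('a) - i\<close>
  columns is invertible, since a nontrivial combination of these rows cannot vanish in that many
  columns. Solving with \<open>M\<close> and padding by zeros gives \<open>v\<close>.\<close>

lemma rs_mat_solve_prefix:
  fixes \<alpha> :: "'a::{field,finite}"
  assumes prim: "primitive_element \<alpha>" and i: "i < CARD('a)"
  shows "\<exists>v\<in>carrier_vec CARD('a). (\<forall>j\<in>{CARD('a) - i..<CARD('a)}. v $ j = 0) \<and>
    (\<forall>r\<in>{i..<CARD('a)}. (rs_mat \<alpha> *\<^sub>v v) $ r = (if r = i then 1 else 0))"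
proof -
  let ?q = "CARD('a)" and ?G = "rs_mat \<alpha>"
  define m where "m = ?q - i"
  define M where "M = mat m m (\<lambda>(r, t). ?G $$ (i + r, t))"
  have M: "M \<in> carrier_mat m m" by (simp add: M_def)
  have m: "m > 0" "m \<le> ?q" "i + m = ?q" using i by (auto simp: m_def)
  have "det M \<noteq> 0"
  proof
    assume "det M = 0"
    then have "det (transpose_mat M) = 0" by (simp add: det_transpose[OF M])
    then obtain v where v: "v \<in> carrier_vec m" "v \<noteq> 0\<^sub>v m" "transpose_mat M *\<^sub>v v = 0\<^sub>v m"
      using det_0_iff_vec_prod_zero[of "transpose_mat M" m] M by auto
    define c where "c k = v $ (k - i)" for k
    have "\<exists>k\<in>{i..<?q}. c k \<noteq> 0"
    proof (rule ccontr)
      assume *: "\<not> ?thesis"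
      have "v $ r = 0" if "r < m" for r
        using bspec[OF *[simplified], of "i + r"] that m by (auto simp: c_def)
      then have "v = 0\<^sub>v m" using v(1) by (intro eq_vecI) auto
      then show False using v(2) by simp
    qed
    note card = rs_mat_card_zeros[OF prim this]
    have zero: "(\<Sum>k=i..<?q. c k * ?G $$ (k, j)) = 0" if "j < m" for j
    proof -
      have "(transpose_mat M *\<^sub>v v) $ j = (\<Sum>r<m. v $ r * ?G $$ (i + r, j))"
        using that v(1) M by (auto simp: scalar_prod_def mult.commute M_def atLeast0LessThan intro!: sum.cong)
      also have "\<dots> = (\<Sum>k=i..<?q. c k * ?G $$ (k, j))"
        using m by (intro sum.reindex_bij_witness[of _ "\<lambda>k. k - i" "\<lambda>r. i + r"]) (auto simp: c_def)
      finally show ?thesis using v(3) that by simp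
    qed
    have "m = card {..<m}" by simp
    also have "\<dots> \<le> card {j. j < ?q \<and> (\<Sum>k=i..<?q. c k * ?G $$ (k, j)) = 0}"
      using zero m by (intro card_mono) auto
    finally show False using card m by simp
  qed
  note N = inv_mat[OF M this]
  define x where "x = col (inv_mat M) 0"
  have x: "x \<in> carrier_vec m" unfolding x_def by (rule col_carrier_vec[OF m(1) N(1)])
  have Mx: "(\<Sum>t<m. ?G $$ (i + r, t) * x $ t) = (if r = 0 then 1 else 0)" if "r < m" for r
  proof -
    have "(M * inv_mat M) $$ (r, 0) = (\<Sum>t<m. ?G $$ (i + r, t) * x $ t)"
      using that M N(1) m by (auto simp: scalar_prod_def x_def M_def atLeast0LessThan intro!: sum.cong)
    then show ?thesis using that m N(2) by simp
  qed
  define v where "v = vec ?q (\<lambda>j. if j < m then x $ j else 0)"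
  have Gv: "(?G *\<^sub>v v) $ r = (if r = i then 1 else 0)" if "i \<le> r" "r < ?q" for r
  proof -
    have "(?G *\<^sub>v v) $ r = (\<Sum>j<?q. ?G $$ (r, j) * (if j < m then x $ j else 0))"
      using that by (simp add: scalar_prod_def v_def atLeast0LessThan)
    also have "\<dots> = (\<Sum>j<m. ?G $$ (i + (r - i), j) * x $ j)"
      using m that by (intro sum.mono_neutral_cong_right) auto
    also have "\<dots> = (if r = i then 1 else 0)" using that m by (subst Mx) auto
    finally show ?thesis .
  qed
  show ?thesis
    by (intro bexI[of _ v]) (use Gv in \<open>auto simp: v_def m_def\<close>)
qed

text \<open>Multiplying by \<open>?G\<close> turns the columns of the inverse into unit vectors. So
  a vector is column \<open>i\<close> modulo the earlier columns exactly if its image agrees with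
  the \<open>i\<close>-th unit vector from position \<open>i\<close> on. Small support is then
  excluded by duality with the rows, and \<open>rs_mat_solve_prefix\<close> attains the
  bound.\<close>

lemma Ds_rs_mat:
  fixes \<alpha> :: "'a::{field,finite}"
  assumes prim: "primitive_element \<alpha>" and i: "i < CARD('a)"
  shows "Ds (rs_mat \<alpha>) i = CARD('a) - i"
proof -
  let ?q = "CARD('a)" and ?G = "rs_mat \<alpha>"
  define B where "B = inv_mat ?G"
  have B: "B \<in> carrier_mat ?q ?q" "?G * B = 1\<^sub>m ?q" "B * ?G = 1\<^sub>m ?q"
    unfolding B_def by (rule inv_mat[OF rs_mat_carrier(1) det_rs_mat[OF prim]])+
  let ?w = "\<lambda>c. vec ?q (\<lambda>j. \<Sum>k=0..<i. c k * col B k $ j)"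
  have span: "vec_span ?q (col B ` {..<i}) = {?w c | c. True}"
    unfolding atLeast0LessThan[symmetric] by (rule vec_span_image, rule col_carrier_vec[OF _ B(1)]) (use i in simp)
  have GB: "(\<Sum>j<?q. ?G $$ (r, j) * B $$ (j, k)) = (if r = k then 1 else 0)" if "r < ?q" "k < ?q" for r k
  proof -
    have "(?G * B) $$ (r, k) = (\<Sum>j<?q. ?G $$ (r, j) * B $$ (j, k))"
      using that B(1) by (auto simp: scalar_prod_def atLeast0LessThan intro!: sum.cong)
    then show ?thesis using that B(2) by simp
  qed
  show ?thesis
    unfolding Ds_def rs_mat_carrier B_def[symmetric] span
  proof (rule hamming_set_eqI)
    fix w assume "w \<in> {?w c | c. True}"
    then obtain c where w: "w = ?w c" by blast
    define v where "v j = B $$ (j, i) - (\<Sum>k<i. c k * B $$ (j, k))" for j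
    have Gv: "(\<Sum>j<?q. ?G $$ (r, j) * v j) = (if r = i then 1 else 0)" if "i \<le> r" "r < ?q" for r
    proof -
      have "(\<Sum>j<?q. ?G $$ (r, j) * v j) = (\<Sum>j<?q. ?G $$ (r, j) * B $$ (j, i))
          - (\<Sum>k<i. c k * (\<Sum>j<?q. ?G $$ (r, j) * B $$ (j, k)))"
        unfolding v_def right_diff_distrib sum_subtractf sum_distrib_left
        by (subst (2) sum.swap) (simp add: mult_ac)
      also have "(\<Sum>k<i. c k * (\<Sum>j<?q. ?G $$ (r, j) * B $$ (j, k))) = 0"
        using that by (intro sum.neutral) (auto simp: GB)
      finally show ?thesis using that i by (simp add: GB)
    qed
    define N where "N = {j. j < ?q \<and> v j \<noteq> 0}"
    have ham: "hamming (col B i) w = card N"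
      unfolding hamming_def N_def w using B(1) i
      by (intro arg_cong[of _ _ card]) (auto simp: v_def atLeast0LessThan)
    show "?q - i \<le> hamming (col B i) w"
    proof (rule ccontr)
      assume "\<not> ?thesis"
      then have "card N \<le> ?q - 1 - i" using ham by simp
      moreover have "N \<subseteq> {..<?q}" by (auto simp: N_def)
      ultimately obtain d where d: "d i \<noteq> 0"
        "\<And>j. j \<in> N \<Longrightarrow> (\<Sum>k=i..<?q. d k * ?G $$ (k, j)) = 0"
        using rs_mat_annihilate[OF prim i, of N] by auto
      \<comment> \<open>The pairing of \<open>v\<close> with the row combination \<open>d\<close> is
        computed in two ways: \<open>d\<close> vanishes on the support of \<open>v\<close>, whereas
        summing over columns first leaves only \<open>d i\<close>.\<close>
      have "0 = (\<Sum>j<?q. v j * (\<Sum>k=i..<?q. d k * ?G $$ (k, j)))"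
        using d(2) by (intro sum.neutral[symmetric]) (auto simp: N_def)
      also have "\<dots> = (\<Sum>k=i..<?q. d k * (\<Sum>j<?q. ?G $$ (k, j) * v j))"
        unfolding sum_distrib_left by (subst sum.swap) (simp add: mult_ac)
      also have "\<dots> = (\<Sum>k=i..<?q. if k = i then d k else 0)"
        by (intro sum.cong) (auto simp: Gv)
      also have "\<dots> = d i" using i by simp
      finally show False using d(1) by simp
    qed
  next
    obtain v where v: "v \<in> carrier_vec ?q" "\<And>j. ?q - i \<le> j \<Longrightarrow> j < ?q \<Longrightarrow> v $ j = 0"
      "\<And>r. i \<le> r \<Longrightarrow> r < ?q \<Longrightarrow> (?G *\<^sub>v v) $ r = (if r = i then 1 else 0)"
      using rs_mat_solve_prefix[OF prim i] by auto
    define e where "e = ?G *\<^sub>v v"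
    have e: "e \<in> carrier_vec ?q" unfolding e_def by (rule mult_mat_vec_carrier[OF rs_mat_carrier(1) v(1)])
    have "B *\<^sub>v e = v"
      unfolding e_def using assoc_mult_mat_vec[OF B(1) rs_mat_carrier(1)[of \<alpha>] v(1)] B(3) v(1) by simp
    have vj: "v $ j = B $$ (j, i) + (\<Sum>k<i. e $ k * B $$ (j, k))" if "j < ?q" for j
    proof -
      have "v $ j = (B *\<^sub>v e) $ j" using \<open>B *\<^sub>v e = v\<close> by simp
      also have "\<dots> = (\<Sum>k<?q. B $$ (j, k) * e $ k)"
        using that B(1) e by (auto simp: scalar_prod_def atLeast0LessThan intro!: sum.cong)
      \<comment> \<open>Beyond position \<open>i\<close> the entries of \<open>e\<close> vanish, so
        only column \<open>i\<close> and the earlier columns remain.\<close>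
      also have "\<dots> = (\<Sum>k<Suc i. B $$ (j, k) * e $ k)"
        using i v(3) by (intro sum.mono_neutral_right) (auto simp: e_def)
      also have "\<dots> = B $$ (j, i) + (\<Sum>k<i. e $ k * B $$ (j, k))"
        using v(3)[of i] i by (simp add: e_def mult.commute)
      finally show ?thesis .
    qed
    have "hamming (col B i) (?w (\<lambda>k. - e $ k)) \<le> card {..<?q - i}"
      unfolding hamming_def
    proof (intro card_mono subsetI)
      fix j assume "j \<in> {j. j < dim_vec (col B i) \<and> col B i $ j \<noteq> ?w (\<lambda>k. - e $ k) $ j}"
      then have j: "j < ?q" and "col B i $ j \<noteq> ?w (\<lambda>k. - e $ k) $ j" using B(1) by auto
      then have "B $$ (j, i) \<noteq> - (\<Sum>k<i. e $ k * B $$ (j, k))"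
        using B(1) i by (simp add: atLeast0LessThan sum_negf)
      then have "v $ j \<noteq> 0" using vj[OF j] by (metis add_eq_0_iff2)
      then show "j \<in> {..<?q - i}" using v(2)[of j] j by (meson lessThan_iff not_le)
    qed simp
    then show "\<exists>w\<in>{?w c | c. True}. hamming (col B i) w \<le> ?q - i"
      by (intro bexI[of _ "?w (\<lambda>k. - e $ k)"] CollectI exI[of _ "\<lambda>k. - e $ k"]) simp_all
  qed
qed

text \<open>The distances are \<open>1, ..., CARD('a)\<close>, increasing in one case and decreasing
  in the other, so both sums of logarithms are \<open>ln (fact CARD('a))\<close>.\<close>

lemma exponent_rs_mat:
  fixes \<alpha> :: "'a::{field,finite}"
  assumes "primitive_element \<alpha>"
  shows Ec_rs_mat: "Ec (rs_mat \<alpha>) = log (real CARD('a)) (fact CARD('a)) / real CARD('a)"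
    and Es_rs_mat: "Es (rs_mat \<alpha>) = log (real CARD('a)) (fact CARD('a)) / real CARD('a)"
proof -
  let ?q = "CARD('a)"
  have fact: "(\<Sum>i<n. ln (real (Suc i))) = ln (fact n :: real)" for n
    by (induction n) (simp_all add: ln_mult del: of_nat_Suc)
  have "(\<Sum>i<?q. ln (real (Dc (rs_mat \<alpha>) i))) = ln (fact ?q)"
    unfolding fact[symmetric] by (intro sum.cong) (simp_all add: Dc_rs_mat[OF assms])
  then show "Ec (rs_mat \<alpha>) = log (real ?q) (fact ?q) / real ?q"
    unfolding Ec_def rs_mat_carrier log_def by simp
  have "(\<Sum>i<?q. ln (real (Ds (rs_mat \<alpha>) i))) = (\<Sum>i<?q. ln (real (?q - i)))"
    by (intro sum.cong) (simp_all add: Ds_rs_mat[OF assms])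
  also have "\<dots> = (\<Sum>i<?q. ln (real (Suc i)))"
    by (rule sum.reindex_bij_witness[of _ "\<lambda>i. ?q - Suc i" "\<lambda>i. ?q - Suc i"]) auto
  finally show "Es (rs_mat \<alpha>) = log (real ?q) (fact ?q) / real ?q"
    unfolding Es_def rs_mat_carrier log_def fact by simp
qed

section \<open>Entropy of distributions with finite support\<close>

text \<open>Entropy in nats; division by \<open>ln (real CARD('a))\<close> later restores the base.
  For infinite support the sum defaults to 0, hence the finiteness assumptions below.\<close>

definition ent :: "'b pmf \<Rightarrow> real" where
  "ent p = - (\<Sum>x\<in>set_pmf p. pmf p x * ln (pmf p x))"

lemma ln_ge_one_minus_inverse:
  fixes t :: real
  assumes "t > 0"
  shows "ln t \<ge> 1 - 1 / t"
  using ln_le_minus_one[of "1 / t"] assms by (simp add: ln_div)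

text \<open>Entropies of different images of \<open>p\<close> become sums over one common index set
  and can be compared term by term.\<close>

lemma ent_map:
  assumes "finite (set_pmf p)"
  shows "ent (map_pmf f p) = - (\<Sum>w\<in>set_pmf p. pmf p w * ln (pmf (map_pmf f p) (f w)))"
proof -
  let ?q = "map_pmf f p"
  have "(\<Sum>x\<in>set_pmf ?q. pmf ?q x * ln (pmf ?q x)) = measure_pmf.expectation ?q (\<lambda>x. ln (pmf ?q x))"
    using assms by (subst integral_measure_pmf_real[of "set_pmf ?q"]) (auto simp: mult.commute)
  also have "\<dots> = measure_pmf.expectation p (\<lambda>w. ln (pmf ?q (f w)))"
    by simp
  also have "\<dots> = (\<Sum>w\<in>set_pmf p. pmf p w * ln (pmf ?q (f w)))"
    using assms by (subst integral_measure_pmf_real[of "set_pmf p"]) (auto simp: mult.commute)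
  finally show ?thesis by (simp add: ent_def)
qed

lemma pmf_map_finite:
  assumes "finite (set_pmf p)"
  shows "pmf (map_pmf f p) y = (\<Sum>x\<in>{x\<in>set_pmf p. f x = y}. pmf p x)"
proof -
  have "pmf (map_pmf f p) y = measure p (f -` {y} \<inter> set_pmf p)"
    by (simp add: pmf_map measure_Int_set_pmf)
  also have "f -` {y} \<inter> set_pmf p = {x\<in>set_pmf p. f x = y}" by auto
  finally show ?thesis using assms by (simp add: measure_measure_pmf_finite)
qed

lemma pmf_map_ge: "pmf p x \<le> pmf (map_pmf f p) (f x)"
proof -
  have "measure p {x} \<le> measure p (f -` {f x})"
    by (intro measure_pmf.finite_measure_mono) auto
  then show ?thesis by (simp add: pmf_map measure_pmf_single)
qed

lemma ent_map_inj:
  assumes "inj_on f (set_pmf p)"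
  shows "ent (map_pmf f p) = ent p"
proof -
  have "(\<Sum>x\<in>f ` set_pmf p. pmf (map_pmf f p) x * ln (pmf (map_pmf f p) x))
    = (\<Sum>x\<in>set_pmf p. pmf p x * ln (pmf p x))"
    using assms by (subst sum.reindex) (auto simp: pmf_map_inj intro!: sum.cong)
  then show ?thesis by (simp add: ent_def)
qed

text \<open>Only the partition of the support into fibres matters: maps with equal fibres differ by
  a bijection \<open>h\<close> between their images.\<close>

lemma ent_map_cong:
  assumes "\<And>w w'. w \<in> set_pmf p \<Longrightarrow> w' \<in> set_pmf p \<Longrightarrow> f w = f w' \<longleftrightarrow> g w = g w'"
  shows "ent (map_pmf f p) = ent (map_pmf g p)"
proof -
  define h where "h y = g (SOME w. w \<in> set_pmf p \<and> f w = y)" for y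
  have h: "h (f w) = g w" if "w \<in> set_pmf p" for w
  proof -
    have "(SOME w'. w' \<in> set_pmf p \<and> f w' = f w) \<in> set_pmf p \<and> f (SOME w'. w' \<in> set_pmf p \<and> f w' = f w) = f w"
      by (rule someI_ex) (use that in blast)
    then show ?thesis unfolding h_def using assms that by blast
  qed
  have "map_pmf g p = map_pmf h (map_pmf f p)"
    unfolding map_pmf_comp by (rule map_pmf_cong) (auto simp: h)
  moreover have "inj_on h (set_pmf (map_pmf f p))"
    using assms by (auto simp: inj_on_def h)
  ultimately show ?thesis by (simp add: ent_map_inj)
qed

lemma ent_nonneg: "ent p \<ge> 0"
proof -
  have "pmf p x * ln (pmf p x) \<le> 0" if "x \<in> set_pmf p" for x
    using that pmf_le_1[of p x] by (simp add: mult_le_0_iff pmf_positive)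
  then show ?thesis by (simp add: ent_def sum_nonpos)
qed

lemma ent_return [simp]: "ent (return_pmf x) = 0"
  by (simp add: ent_def)

text \<open>Gibbs' inequality against the uniform law on \<open>A\<close>.\<close>

lemma ent_le_ln_card:
  assumes "finite A" "set_pmf p \<subseteq> A"
  shows "ent p \<le> ln (real (card A))"
proof -
  have fin: "finite (set_pmf p)" using assms finite_subset by blast
  have A: "card A > 0" using assms set_pmf_not_empty[of p] by (auto simp: card_gt_0_iff)
  have sum1: "(\<Sum>x\<in>set_pmf p. pmf p x) = 1" by (rule sum_pmf_eq_1[OF fin]) simp
  have "0 \<le> 1 - real (card (set_pmf p)) / real (card A)"
    using card_mono[OF assms] A by simp
  also have "\<dots> = (\<Sum>x\<in>set_pmf p. pmf p x - 1 / real (card A))"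
    by (simp add: sum_subtractf sum1)
  also have "\<dots> = (\<Sum>x\<in>set_pmf p. pmf p x * (1 - 1 / (pmf p x * real (card A))))"
    using A by (intro sum.cong) (auto simp: set_pmf_iff field_simps)
  also have "\<dots> \<le> (\<Sum>x\<in>set_pmf p. pmf p x * ln (pmf p x * real (card A)))"
    using A by (intro sum_mono mult_left_mono ln_ge_one_minus_inverse) (auto simp: pmf_positive)
  also have "\<dots> = (\<Sum>x\<in>set_pmf p. pmf p x * ln (pmf p x) + pmf p x * ln (real (card A)))"
    using A by (intro sum.cong) (auto simp: ln_mult pmf_positive distrib_left)
  also have "\<dots> = - ent p + ln (real (card A))"
    by (simp add: sum.distrib ent_def sum_distrib_right[symmetric] sum1)
  finally show ?thesis by simp
qed

lemma ent_map_le: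
  assumes "finite (set_pmf p)"
  shows "ent (map_pmf f p) \<le> ent p"
proof -
  have "pmf p w * ln (pmf p w) \<le> pmf p w * ln (pmf (map_pmf f p) (f w))" if "w \<in> set_pmf p" for w
    using that pmf_map_ge[of p w f] pmf_positive[OF that] by (intro mult_left_mono) (auto simp: ln_mono)
  then show ?thesis unfolding ent_map[OF assms] by (simp add: ent_def sum_mono)
qed

text \<open>Nonnegativity of the conditional mutual information of \<open>f\<close> and
  \<open>g\<close> given a common function \<open>z\<close> of both. For constant \<open>z\<close>
  this is subadditivity.\<close>

lemma ent_submodular:
  assumes fin: "finite (set_pmf p)"
    and z: "\<And>w. w \<in> set_pmf p \<Longrightarrow> z w = \<phi> (f w)" "\<And>w. w \<in> set_pmf p \<Longrightarrow> z w = \<psi> (g w)"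
  shows "ent (map_pmf (\<lambda>w. (f w, g w)) p) + ent (map_pmf z p) \<le> ent (map_pmf f p) + ent (map_pmf g p)"
proof -
  let ?J = "map_pmf (\<lambda>w. (f w, g w)) p" and ?F = "map_pmf f p" and ?G = "map_pmf g p" and ?Z = "map_pmf z p"
  \<comment> \<open>Gibbs' inequality against the law that makes \<open>f\<close> and \<open>g\<close> independent given \<open>z\<close>;
    \<open>?k\<close> is its density\<close>
  let ?k = "\<lambda>(a, b). pmf ?F a * pmf ?G b / (pmf ?J (a, b) * pmf ?Z (\<phi> a))"
  have pos: "pmf (map_pmf h p) (h w) > 0" if "w \<in> set_pmf p" for h :: "'a \<Rightarrow> 'x" and w
    using that by (intro pmf_positive) auto
  note pos = pos[of _ "\<lambda>w. (f w, g w)"] pos[of _ f] pos[of _ g] pos[of _ z]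
  have sum1: "(\<Sum>x\<in>set_pmf p. pmf p x) = 1" by (rule sum_pmf_eq_1[OF fin]) simp
  have Zg: "?Z = map_pmf \<psi> ?G"
    unfolding map_pmf_comp by (rule map_pmf_cong[OF refl]) (rule z(2))
  have "(\<Sum>w\<in>set_pmf p. pmf p w * ?k (f w, g w)) = measure_pmf.expectation p (\<lambda>w. ?k (f w, g w))"
    using fin by (subst integral_measure_pmf_real[of "set_pmf p"]) (auto simp: mult.commute)
  also have "\<dots> = measure_pmf.expectation ?J ?k" by simp
  also have "\<dots> = (\<Sum>c\<in>set_pmf ?J. ?k c * pmf ?J c)"
    using fin by (intro integral_measure_pmf_real) auto
  also have "\<dots> = (\<Sum>(a, b)\<in>set_pmf ?J. pmf ?F a * pmf ?G b / pmf ?Z (\<phi> a))"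
    by (intro sum.cong) (auto simp: set_pmf_iff simp del: set_map_pmf)
  \<comment> \<open>The sum is enlarged to all pairs that agree on the common value; there the
    conditionally independent law has total mass 1.\<close>
  also have "\<dots> \<le> (\<Sum>(a, b)\<in>(SIGMA a:set_pmf ?F. {b\<in>set_pmf ?G. \<psi> b = \<phi> a}). pmf ?F a * pmf ?G b / pmf ?Z (\<phi> a))"
  proof (intro sum_mono2)
    show "finite (SIGMA a:set_pmf ?F. {b\<in>set_pmf ?G. \<psi> b = \<phi> a})"
      using fin by (intro finite_SigmaI) auto
    show "set_pmf ?J \<subseteq> (SIGMA a:set_pmf ?F. {b\<in>set_pmf ?G. \<psi> b = \<phi> a})"
      by (auto simp: z(1)[symmetric] z(2)[symmetric])
  qed (auto simp del: set_map_pmf)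
  also have "\<dots> = (\<Sum>a\<in>set_pmf ?F. \<Sum>b\<in>{b\<in>set_pmf ?G. \<psi> b = \<phi> a}. pmf ?F a * pmf ?G b / pmf ?Z (\<phi> a))"
    using fin by (intro sum.Sigma[symmetric]) auto
  also have "\<dots> = (\<Sum>a\<in>set_pmf ?F. pmf ?F a * (pmf ?Z (\<phi> a) / pmf ?Z (\<phi> a)))"
  proof (intro sum.cong refl)
    fix a
    have fing: "finite (set_pmf ?G)" using fin by simp
    have "pmf ?Z (\<phi> a) = (\<Sum>b\<in>{b\<in>set_pmf ?G. \<psi> b = \<phi> a}. pmf ?G b)"
      unfolding Zg by (rule pmf_map_finite[OF fing])
    then show "(\<Sum>b\<in>{b\<in>set_pmf ?G. \<psi> b = \<phi> a}. pmf ?F a * pmf ?G b / pmf ?Z (\<phi> a))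
        = pmf ?F a * (pmf ?Z (\<phi> a) / pmf ?Z (\<phi> a))"
      by (simp only: sum_distrib_left[symmetric] sum_divide_distrib[symmetric] times_divide_eq_right)
  qed
  also have "\<dots> = (\<Sum>a\<in>set_pmf ?F. pmf ?F a)"
    using pos(4) z by (intro sum.cong) (auto, metis less_irrefl z(1))
  also have "\<dots> = 1" using fin by (intro sum_pmf_eq_1) auto
  finally have le1: "(\<Sum>w\<in>set_pmf p. pmf p w * ?k (f w, g w)) \<le> 1" .
  have "0 \<le> (\<Sum>w\<in>set_pmf p. pmf p w * (1 - ?k (f w, g w)))"
    using le1 by (simp add: right_diff_distrib sum_subtractf sum1)
  also have "\<dots> \<le> (\<Sum>w\<in>set_pmf p. pmf p w * (ln (pmf ?J (f w, g w)) + ln (pmf ?Z (z w))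
      - ln (pmf ?F (f w)) - ln (pmf ?G (g w))))"
  proof (intro sum_mono mult_left_mono)
    fix w assume w: "w \<in> set_pmf p"
    have "1 - ?k (f w, g w) = 1 - 1 / (pmf ?J (f w, g w) * pmf ?Z (z w) / (pmf ?F (f w) * pmf ?G (g w)))"
      using z(1)[OF w] by simp
    also have "\<dots> \<le> ln (pmf ?J (f w, g w) * pmf ?Z (z w) / (pmf ?F (f w) * pmf ?G (g w)))"
      using pos[OF w] by (intro ln_ge_one_minus_inverse) simp
    also have "\<dots> = ln (pmf ?J (f w, g w)) + ln (pmf ?Z (z w)) - ln (pmf ?F (f w)) - ln (pmf ?G (g w))"
      using pos[OF w] by (simp add: ln_div ln_mult)
    finally show "1 - ?k (f w, g w) \<le> ln (pmf ?J (f w, g w)) + ln (pmf ?Z (z w)) - ln (pmf ?F (f w)) - ln (pmf ?G (g w))" .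
  qed simp
  also have "\<dots> = ent ?F + ent ?G - ent ?J - ent ?Z"
    unfolding ent_map[OF fin] by (simp add: right_diff_distrib distrib_left sum_subtractf sum.distrib)
  finally show ?thesis by simp
qed

lemma ent_pair:
  assumes "finite (set_pmf p)" "finite (set_pmf q)"
  shows "ent (pair_pmf p q) = ent p + ent q"
proof -
  have sum1: "(\<Sum>x\<in>set_pmf p. pmf p x) = 1" "(\<Sum>x\<in>set_pmf q. pmf q x) = 1"
    using assms by (auto intro: sum_pmf_eq_1)
  have "(\<Sum>x\<in>set_pmf (pair_pmf p q). pmf (pair_pmf p q) x * ln (pmf (pair_pmf p q) x))
    = (\<Sum>a\<in>set_pmf p. \<Sum>b\<in>set_pmf q. pmf p a * pmf q b * ln (pmf p a * pmf q b))"
    unfolding set_pair_pmf sum.cartesian_product by (intro sum.cong) (auto simp: pmf_pair)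
  also have "\<dots> = (\<Sum>a\<in>set_pmf p. \<Sum>b\<in>set_pmf q. pmf q b * (pmf p a * ln (pmf p a)) + pmf p a * (pmf q b * ln (pmf q b)))"
    by (intro sum.cong) (auto simp: ln_mult pmf_positive algebra_simps)
  also have "\<dots> = - ent p - ent q"
    by (simp add: sum.distrib sum_distrib_left[symmetric] sum_distrib_right[symmetric] sum1 ent_def)
  finally show ?thesis by (simp add: ent_def)
qed

lemma cond_ent_nonneg:
  assumes "finite (set_pmf p)"
  shows "ent (map_pmf g p) \<le> ent (map_pmf (\<lambda>w. (f w, g w)) p)"
  using ent_map_le[of "map_pmf (\<lambda>w. (f w, g w)) p" snd] assms by (simp add: map_pmf_comp)

lemma cond_ent_le:
  fixes f :: "'w \<Rightarrow> 'a::finite"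
  assumes "finite (set_pmf p)"
  shows "ent (map_pmf (\<lambda>w. (f w, g w)) p) - ent (map_pmf g p) \<le> ln CARD('a)"
proof -
  have "ent (map_pmf (\<lambda>w. (f w, g w)) p) + ent (map_pmf (\<lambda>_. ()) p) \<le> ent (map_pmf f p) + ent (map_pmf g p)"
    by (rule ent_submodular[OF assms]) auto
  moreover have "ent (map_pmf (\<lambda>_. ()) p) = 0" by (simp add: map_pmf_const)
  moreover have "ent (map_pmf f p) \<le> ln CARD('a)" by (rule ent_le_ln_card) auto
  ultimately show ?thesis by simp
qed

section \<open>Conditional entropy and product distributions\<close>

text \<open>Turns the infinite sum in \<open>cond_entropy\<close> into an expectation, which can be
  computed by iterated integration.\<close>

lemma infsum_pmf:
  fixes k :: "'b \<Rightarrow> real"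
  assumes "integrable (measure_pmf R) k"
  shows "(\<Sum>\<^sub>\<infinity>x\<in>UNIV. pmf R x * k x) = measure_pmf.expectation R k"
proof -
  have "integrable (count_space UNIV) (\<lambda>x. pmf R x *\<^sub>R k x)"
    using assms unfolding measure_pmf_eq_density by (subst (asm) integrable_density) auto
  then have "Infinite_Set_Sum.abs_summable_on (\<lambda>x. pmf R x * k x) UNIV"
    by (simp add: Infinite_Set_Sum.abs_summable_on_def)
  then show ?thesis
    by (simp add: infsetsum_infsum[symmetric] pmf_expectation_eq_infsetsum)
qed

lemma pmf_bind_Pair:
  "pmf (bind_pmf N (\<lambda>z. map_pmf (Pair z) (\<kappa> z))) (z, c) = pmf N z * pmf (\<kappa> z) c"
proof -
  have "pmf (map_pmf (Pair z') (\<kappa> z')) (z, c) = indicator {z} z' * pmf (\<kappa> z) c" for z'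
  proof (cases "z' = z")
    case True
    then show ?thesis by (simp add: pmf_map_inj' inj_on_def)
  next
    case False
    then have "(z, c) \<notin> set_pmf (map_pmf (Pair z') (\<kappa> z'))" by auto
    then show ?thesis using False by (simp add: pmf_eq_0_set_pmf)
  qed
  then show ?thesis by (simp add: pmf_bind measure_pmf_single)
qed

text \<open>Given \<open>z\<close>, everything lives on a finite support, so the conditional entropy
  is an average of differences of finite entropies. As \<open>T\<close> is injective, observing
  \<open>T (g w) z\<close> means observing \<open>g w\<close> and \<open>z\<close>, and the mass of
  \<open>z\<close> cancels in the quotient of joint and marginal mass.\<close>

lemma cond_entropy_bind:
  fixes N :: "'z pmf" and \<kappa> :: "'z \<Rightarrow> 'w pmf" and f :: "'w \<Rightarrow> 'a::finite"
    and g :: "'w \<Rightarrow> 'b" and T :: "'b \<Rightarrow> 'z \<Rightarrow> 'o"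
  assumes fin: "\<And>z. z \<in> set_pmf N \<Longrightarrow> finite (set_pmf (\<kappa> z))"
    and T: "\<And>b z b' z'. T b z = T b' z' \<Longrightarrow> b = b' \<and> z = z'"
    and q: "CARD('a) \<ge> 2"
  shows "cond_entropy (bind_pmf N (\<lambda>z. map_pmf (\<lambda>w. (f w, T (g w) z)) (\<kappa> z)))
    = measure_pmf.expectation N
        (\<lambda>z. ent (map_pmf (\<lambda>w. (f w, g w)) (\<kappa> z)) - ent (map_pmf g (\<kappa> z))) / ln (real CARD('a))"
proof -
  define R where "R = bind_pmf N (\<lambda>z. map_pmf (\<lambda>w. (f w, T (g w) z)) (\<kappa> z))"
  define J where "J z = map_pmf (\<lambda>w. (f w, g w)) (\<kappa> z)" for z
  define M where "M z = map_pmf g (\<kappa> z)" for z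
  define D where "D z = ent (J z) - ent (M z)" for z
  define k where "k = (\<lambda>(x, y). - log CARD('a) (pmf R (x, y) / pmf (map_pmf snd R) y))"
  have lnq: "ln (real CARD('a)) > 0" using q by simp
  have "R = map_pmf (\<lambda>(z, x, b). (x, T b z)) (bind_pmf N (\<lambda>z. map_pmf (Pair z) (J z)))"
    by (simp add: R_def J_def map_bind_pmf map_pmf_comp)
  moreover have "inj (\<lambda>(z, x, b). (x :: 'a, T b z))" by (auto simp: inj_on_def dest: T)
  ultimately have pR: "pmf R (x, T b z) = pmf N z * pmf (J z) (x, b)" for x b z
    using pmf_map_inj'[of "\<lambda>(z, x, b). (x, T b z)" _ "(z, x, b)"] by (simp add: pmf_bind_Pair)
  have "map_pmf snd R = map_pmf (\<lambda>(z, b). T b z) (bind_pmf N (\<lambda>z. map_pmf (Pair z) (M z)))"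
    by (simp add: R_def M_def map_bind_pmf map_pmf_comp)
  moreover have "inj (\<lambda>(z, b). T b z)" by (auto simp: inj_on_def dest: T)
  ultimately have pM: "pmf (map_pmf snd R) (T b z) = pmf N z * pmf (M z) b" for b z
    using pmf_map_inj'[of "\<lambda>(z, b). T b z" _ "(z, b)"] by (simp add: pmf_bind_Pair)
  have kT: "k (f w, T (g w) z) = (ln (pmf (M z) (g w)) - ln (pmf (J z) (f w, g w))) / ln (real CARD('a))"
    and kpos: "k (f w, T (g w) z) \<ge> 0"
    if z: "z \<in> set_pmf N" and w: "w \<in> set_pmf (\<kappa> z)" for z w
  proof -
    have J0: "pmf (J z) (f w, g w) > 0" using w unfolding J_def by (intro pmf_positive) auto
    have le: "pmf (J z) (f w, g w) \<le> pmf (M z) (g w)"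
      using pmf_map_ge[of "J z" "(f w, g w)" snd] by (simp add: J_def M_def map_pmf_comp)
    have N0: "pmf N z > 0" using z by (rule pmf_positive)
    show eq: "k (f w, T (g w) z) = (ln (pmf (M z) (g w)) - ln (pmf (J z) (f w, g w))) / ln (real CARD('a))"
      using J0 le N0 by (simp add: k_def pR pM log_def ln_div ln_mult diff_divide_distrib)
    show "k (f w, T (g w) z) \<ge> 0"
      unfolding eq using J0 le lnq by (intro divide_nonneg_pos) auto
  qed
  \<comment> \<open>There may be infinitely many observations, so integrability of \<open>k\<close>
    is not clear in advance. Nonnegativity permits integrating it in the extended sense first; the
    finite value then yields integrability.\<close>
  have k_nonneg: "AE x in R. k x \<ge> 0"
    by (auto simp: AE_measure_pmf_iff R_def kpos)
  have inner: "(\<integral>\<^sup>+w. ennreal (k (f w, T (g w) z)) \<partial>\<kappa> z) = ennreal (D z / ln (real CARD('a)))"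
    if z: "z \<in> set_pmf N" for z
  proof -
    have "(\<integral>\<^sup>+w. ennreal (k (f w, T (g w) z)) \<partial>\<kappa> z)
        = ennreal (measure_pmf.expectation (\<kappa> z) (\<lambda>w. k (f w, T (g w) z)))"
      using fin[OF z] kpos[OF z]
      by (intro nn_integral_eq_integral integrable_measure_pmf_finite) (auto simp: AE_measure_pmf_iff)
    also have "measure_pmf.expectation (\<kappa> z) (\<lambda>w. k (f w, T (g w) z))
        = (\<Sum>w\<in>set_pmf (\<kappa> z). pmf (\<kappa> z) w * k (f w, T (g w) z))"
      using fin[OF z] by (subst integral_measure_pmf_real[of "set_pmf (\<kappa> z)"]) (auto simp: mult.commute)
    also have "\<dots> = D z / ln (real CARD('a))"
      unfolding D_def J_def M_def ent_map[OF fin[OF z]]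
      by (simp add: kT[OF z] J_def M_def sum_divide_distrib[symmetric] right_diff_distrib sum_subtractf)
    finally show ?thesis .
  qed
  have D: "0 \<le> D z" "D z \<le> ln (real CARD('a))" if "z \<in> set_pmf N" for z
    using cond_ent_nonneg[OF fin[OF that], of g f] cond_ent_le[OF fin[OF that], of f g]
    by (auto simp: D_def J_def M_def)
  have intD: "integrable (measure_pmf N) D"
    using D by (intro measure_pmf.integrable_const_bound[where B = "ln (real CARD('a))"]) (auto simp: AE_measure_pmf_iff)
  have "(\<integral>\<^sup>+x. ennreal (k x) \<partial>R) = (\<integral>\<^sup>+z. \<integral>\<^sup>+w. ennreal (k (f w, T (g w) z)) \<partial>\<kappa> z \<partial>N)"
    by (simp add: R_def)
  also have "\<dots> = (\<integral>\<^sup>+z. ennreal (D z / ln (real CARD('a))) \<partial>N)"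
    by (intro nn_integral_cong_AE) (auto simp: AE_measure_pmf_iff inner)
  also have "\<dots> = ennreal (measure_pmf.expectation N (\<lambda>z. D z / ln (real CARD('a))))"
    using D lnq intD by (intro nn_integral_eq_integral) (auto simp: AE_measure_pmf_iff)
  finally have nn: "(\<integral>\<^sup>+x. ennreal (k x) \<partial>R) = ennreal (measure_pmf.expectation N D / ln (real CARD('a)))"
    by simp
  have ED: "0 \<le> measure_pmf.expectation N D"
    using D by (intro integral_nonneg_AE) (auto simp: AE_measure_pmf_iff)
  have "integrable (measure_pmf R) k"
    by (rule integrableI_nn_integral_finite[OF _ k_nonneg nn]) simp
  then have "(\<Sum>\<^sub>\<infinity>x\<in>UNIV. pmf R x * k x) = measure_pmf.expectation R k"
    by (rule infsum_pmf)
  also have "\<dots> = measure_pmf.expectation N D / ln (real CARD('a))"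
    using ED lnq by (simp add: integral_eq_nn_integral[OF _ k_nonneg] nn)
  finally have "(\<Sum>\<^sub>\<infinity>x\<in>UNIV. pmf R x * k x) = measure_pmf.expectation N D / ln (real CARD('a))" .
  moreover have "cond_entropy R = (\<Sum>\<^sub>\<infinity>x\<in>UNIV. pmf R x * k x)"
    unfolding cond_entropy_def infsum_uminus[symmetric]
    by (intro infsum_cong) (auto simp: k_def)
  ultimately show ?thesis unfolding R_def D_def J_def M_def by simp
qed

text \<open>\<open>M\<close> is the law of the observation and \<open>K y\<close> the conditional
  law of the input given \<open>y\<close>. All later computations start from sources in this
  form.\<close>

lemma pmf_disintegrate:
  fixes P :: "('a \<times> 'y) pmf"
  shows "\<exists>M K. P = bind_pmf M (\<lambda>y. map_pmf (\<lambda>x. (x, y)) (K y))"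
proof -
  define C where "C y = cond_pmf P {z. y = snd z}" for y
  have "P = bind_pmf (map_pmf snd P) C"
    unfolding C_def
    by (rule bind_cond_pmf_cancel[symmetric])
      (auto simp: measure_pmf_single pmf_map vimage_def eq_commute intro!: arg_cong[of _ _ "measure _"])
  also have "\<dots> = bind_pmf (map_pmf snd P) (\<lambda>y. map_pmf (\<lambda>x. (x, y)) (map_pmf fst (C y)))"
  proof (rule bind_pmf_cong[OF refl])
    fix y assume "y \<in> set_pmf (map_pmf snd P)"
    then have "set_pmf P \<inter> {z. y = snd z} \<noteq> {}" by auto
    then have set: "set_pmf (C y) = set_pmf P \<inter> {z. y = snd z}" by (simp add: C_def set_cond_pmf)
    show "C y = map_pmf (\<lambda>x. (x, y)) (map_pmf fst (C y))"
      unfolding map_pmf_comp by (rule map_pmf_idI[symmetric]) (auto simp: set)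
  qed
  finally show ?thesis by (intro exI[of _ "map_pmf snd P"] exI[of _ "\<lambda>y. map_pmf fst (C y)"])
qed

text \<open>Independent coordinates with individual laws \<open>K y\<close>: the law of the inputs
  of a basic transform once all observations are fixed.\<close>

primrec list_pmf :: "('y \<Rightarrow> 'x pmf) \<Rightarrow> 'y list \<Rightarrow> 'x list pmf" where
  "list_pmf K [] = return_pmf []"
| "list_pmf K (y # ys) = map_pmf (\<lambda>(x, xs). x # xs) (pair_pmf (K y) (list_pmf K ys))"

lemma length_list_pmf: "xs \<in> set_pmf (list_pmf K ys) \<Longrightarrow> length xs = length ys"
  by (induction ys arbitrary: xs) auto

lemma finite_list_pmf:
  assumes "\<And>y. y \<in> set ys \<Longrightarrow> finite (set_pmf (K y))"
  shows "finite (set_pmf (list_pmf K ys))"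
  using assms by (induction ys) auto

lemma ent_list_pmf:
  assumes "\<And>y. y \<in> set ys \<Longrightarrow> finite (set_pmf (K y))"
  shows "ent (list_pmf K ys) = (\<Sum>y\<leftarrow>ys. ent (K y))"
  using assms
proof (induction ys)
  case (Cons y ys)
  have "ent (list_pmf K (y # ys)) = ent (pair_pmf (K y) (list_pmf K ys))"
    unfolding list_pmf.simps by (rule ent_map_inj) (auto simp: inj_on_def)
  also have "\<dots> = ent (K y) + ent (list_pmf K ys)"
    using Cons.prems by (intro ent_pair finite_list_pmf) auto
  finally show ?case using Cons by simp
qed simp

lemma list_pmf_nth:
  assumes "j < length ys"
  shows "map_pmf (\<lambda>xs. xs ! j) (list_pmf K ys) = K (ys ! j)"
  using assms
proof (induction ys arbitrary: j)
  case (Cons y ys)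
  show ?case
  proof (cases j)
    case 0
    then show ?thesis by (simp add: map_pmf_comp case_prod_unfold map_fst_pair_pmf)
  next
    case (Suc i)
    have "map_pmf (\<lambda>xs. xs ! j) (list_pmf K (y # ys))
      = map_pmf (\<lambda>xs. xs ! i) (map_pmf snd (pair_pmf (K y) (list_pmf K ys)))"
      by (simp add: map_pmf_comp case_prod_unfold Suc)
    then show ?thesis using Cons Suc by (simp add: map_snd_pair_pmf)
  qed
qed simp

lemma list_pmf_nth_pair:
  assumes "length ys \<ge> 2"
  shows "map_pmf (\<lambda>xs. (xs ! 0, xs ! 1)) (list_pmf K ys) = pair_pmf (K (ys ! 0)) (K (ys ! 1))"
proof -
  obtain y ys' where ys: "ys = y # ys'" "0 < length ys'"
    using assms by (cases ys) (auto simp: Suc_le_eq)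
  have "map_pmf (\<lambda>xs. (xs ! 0, xs ! 1)) (list_pmf K ys)
    = map_pmf (\<lambda>(x, xs). (x, xs ! 0)) (pair_pmf (K y) (list_pmf K ys'))"
    by (simp add: ys map_pmf_comp case_prod_unfold)
  also have "\<dots> = pair_pmf (K y) (map_pmf (\<lambda>xs. xs ! 0) (list_pmf K ys'))"
    by (simp add: pair_map_pmf2 case_prod_unfold apsnd_def map_prod_def)
  finally show ?thesis using list_pmf_nth[OF ys(2), of K] by (simp add: ys)
qed

lemma list_pmf_nth_triple:
  assumes "2 \<le> j" "j < length ys"
  shows "map_pmf (\<lambda>xs. ((xs ! 0, xs ! 1), xs ! j)) (list_pmf K ys)
    = pair_pmf (pair_pmf (K (ys ! 0)) (K (ys ! 1))) (K (ys ! j))"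
proof -
  obtain y y' ys' i where ys: "ys = y # y' # ys'" and j: "j = Suc (Suc i)" "i < length ys'"
    using assms by (cases ys; cases "tl ys"; cases j; cases "j - 1") auto
  have "map_pmf (\<lambda>xs. ((xs ! 0, xs ! 1), xs ! j)) (list_pmf K ys)
    = do {x \<leftarrow> K y; x' \<leftarrow> K y'; map_pmf (\<lambda>xs. ((x, x'), xs ! i)) (list_pmf K ys')}"
    by (simp add: ys j pair_pmf_def map_bind_pmf bind_map_pmf map_pmf_def[symmetric] bind_assoc_pmf bind_return_pmf)
      (simp add: map_pmf_def bind_assoc_pmf bind_return_pmf)
  also have "\<dots> = do {x \<leftarrow> K y; x' \<leftarrow> K y'; map_pmf (\<lambda>a. ((x, x'), a)) (K (ys' ! i))}"
    by (simp add: list_pmf_nth[OF j(2), symmetric] map_pmf_comp)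
  also have "\<dots> = pair_pmf (pair_pmf (K y) (K y')) (K (ys' ! i))"
    by (simp add: pair_pmf_def map_pmf_def bind_assoc_pmf bind_return_pmf)
  finally show ?thesis by (simp add: ys j)
qed

lemma replicate_pmf_eq_list_pmf: "replicate_pmf n p = list_pmf (\<lambda>_. p) (replicate n ())"
  by (induction n) (simp_all add: pair_pmf_def map_bind_pmf map_pmf_def bind_assoc_pmf bind_return_pmf)

text \<open>All observations can be drawn before all inputs, because the draw of one input commutes
  with the draws of the remaining observations.\<close>

lemma replicate_pmf_bind:
  "replicate_pmf n (bind_pmf M (\<lambda>y. map_pmf (\<lambda>x. (x, y)) (K y)))
    = bind_pmf (replicate_pmf n M) (\<lambda>ys. map_pmf (\<lambda>xs. zip xs ys) (list_pmf K ys))"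
proof (induction n)
  case 0
  show ?case by (simp add: bind_return_pmf)
next
  case (Suc n)
  have "replicate_pmf (Suc n) (bind_pmf M (\<lambda>y. map_pmf (\<lambda>x. (x, y)) (K y)))
    = do {y \<leftarrow> M; x \<leftarrow> K y; ys \<leftarrow> replicate_pmf n M; xs \<leftarrow> list_pmf K ys; return_pmf ((x, y) # zip xs ys)}"
    unfolding replicate_pmf.simps Suc
    by (simp add: bind_assoc_pmf bind_return_pmf map_pmf_def)
  also have "\<dots> = do {y \<leftarrow> M; ys \<leftarrow> replicate_pmf n M; x \<leftarrow> K y; xs \<leftarrow> list_pmf K ys; return_pmf ((x, y) # zip xs ys)}"
    by (subst bind_commute_pmf) (rule refl)
  also have "\<dots> = bind_pmf (replicate_pmf (Suc n) M) (\<lambda>ys. map_pmf (\<lambda>xs. zip xs ys) (list_pmf K ys))"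
    by (simp add: bind_assoc_pmf bind_return_pmf map_pmf_def pair_pmf_def)
  finally show ?case .
qed

section \<open>Entropy under the polar transform\<close>

text \<open>The same description as in \<open>basic_transform\<close>: the message \<open>u\<close>
  with \<open>x = u G\<close>, written with the transpose because vectors are columns.\<close>

definition msg :: "'a::field mat \<Rightarrow> 'a vec \<Rightarrow> 'a vec" where
  "msg G x = (THE u. u \<in> carrier_vec (dim_row G) \<and> x = transpose_mat G *\<^sub>v u)"

definition msg_prefix :: "'a::field mat \<Rightarrow> nat \<Rightarrow> 'a list \<Rightarrow> 'a list" where
  "msg_prefix G i xs = map (\<lambda>j. msg G (vec_of_list xs) $ j) [0..<i]"

text \<open>Entropy of the first \<open>k\<close> messages when the observations are
  \<open>ys\<close>. Its increments in \<open>k\<close> are the conditional entropies of the chain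
  rule.\<close>

definition prefix_ent :: "'a::field mat \<Rightarrow> ('y \<Rightarrow> 'a pmf) \<Rightarrow> nat \<Rightarrow> 'y list \<Rightarrow> real" where
  "prefix_ent G K k ys = ent (map_pmf (msg_prefix G k) (list_pmf K ys))"

section \<open>Messages, prefixes and the chain rule\<close>

lemma msg:
  fixes G :: "'a::field mat"
  assumes G: "G \<in> carrier_mat n n" and det: "det G \<noteq> 0" and x: "x \<in> carrier_vec n"
  shows msg_carrier: "msg G x \<in> carrier_vec n" and transpose_mult_msg: "transpose_mat G *\<^sub>v msg G x = x"
proof -
  have GT: "transpose_mat G \<in> carrier_mat n n" "det (transpose_mat G) \<noteq> 0"
    using G det by (auto simp: det_transpose)
  note B = inv_mat[OF GT]
  let ?B = "inv_mat (transpose_mat G)"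
  have "\<exists>!u. u \<in> carrier_vec (dim_row G) \<and> x = transpose_mat G *\<^sub>v u"
  proof (rule ex1I[of _ "?B *\<^sub>v x"])
    have "transpose_mat G *\<^sub>v (?B *\<^sub>v x) = x"
      using assoc_mult_mat_vec[OF GT(1) B(1) x] B(2) x by simp
    then show "?B *\<^sub>v x \<in> carrier_vec (dim_row G) \<and> x = transpose_mat G *\<^sub>v (?B *\<^sub>v x)"
      using G mult_mat_vec_carrier[OF B(1) x] by simp
    fix u assume u: "u \<in> carrier_vec (dim_row G) \<and> x = transpose_mat G *\<^sub>v u"
    then have "u \<in> carrier_vec n" using G by simp
    then show "u = ?B *\<^sub>v x"
      using assoc_mult_mat_vec[OF B(1) GT(1), of u] B(3) u by simp
  qed
  from theI'[OF this] show "msg G x \<in> carrier_vec n" "transpose_mat G *\<^sub>v msg G x = x"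
    using G by (auto simp: msg_def)
qed

lemma nth_eq_sum_msg:
  fixes G :: "'a::field mat"
  assumes G: "G \<in> carrier_mat n n" and det: "det G \<noteq> 0" and xs: "length xs = n" and j: "j < n"
  shows "xs ! j = (\<Sum>i<n. msg G (vec_of_list xs) $ i * G $$ (i, j))"
proof -
  have x: "vec_of_list xs \<in> carrier_vec n" by (rule carrier_vecI) (simp add: xs)
  have "xs ! j = (transpose_mat G *\<^sub>v msg G (vec_of_list xs)) $ j"
    using transpose_mult_msg[OF G det x] by (simp add: vec_of_list_index)
  also have "\<dots> = (\<Sum>i<n. msg G (vec_of_list xs) $ i * G $$ (i, j))"
    using G j msg_carrier[OF G det x]
    by (auto simp: scalar_prod_def atLeast0LessThan mult.commute intro!: sum.cong)
  finally show ?thesis .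
qed

lemma msg_prefix_eq_iff:
  "msg_prefix G k xs = msg_prefix G k xs'
    \<longleftrightarrow> (\<forall>i<k. msg G (vec_of_list xs) $ i = msg G (vec_of_list xs') $ i)"
  by (auto simp: msg_prefix_def)

lemma msg_prefix_inj:
  fixes G :: "'a::field mat"
  assumes G: "G \<in> carrier_mat n n" and det: "det G \<noteq> 0" and xs: "length xs = n" "length xs' = n"
    and eq: "msg_prefix G n xs = msg_prefix G n xs'"
  shows "xs = xs'"
proof (rule nth_equalityI)
  fix j assume "j < length xs"
  then have j: "j < n" using xs by simp
  show "xs ! j = xs' ! j"
    unfolding nth_eq_sum_msg[OF G det xs(1) j] nth_eq_sum_msg[OF G det xs(2) j]
    using eq by (intro sum.cong) (auto simp: msg_prefix_eq_iff)
qed (use xs in simp)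

lemma basic_transform_bind:
  fixes G :: "'a::field mat" and M :: "('a, 'y) obs pmf" and K :: "('a, 'y) obs \<Rightarrow> 'a pmf"
  assumes "G \<in> carrier_mat n n"
  shows "basic_transform G i (bind_pmf M (\<lambda>y. map_pmf (\<lambda>x. (x, y)) (K y)))
    = bind_pmf (replicate_pmf n M) (\<lambda>ys. map_pmf
        (\<lambda>xs. (msg G (vec_of_list xs) $ i, Trans (msg_prefix G i xs) ys)) (list_pmf K ys))"
proof -
  have "basic_transform G i (bind_pmf M (\<lambda>y. map_pmf (\<lambda>x. (x, y)) (K y)))
    = bind_pmf (replicate_pmf n M) (\<lambda>ys. map_pmf (\<lambda>xs. (msg G (vec_of_list (map fst (zip xs ys))) $ i,
        Trans (msg_prefix G i (map fst (zip xs ys))) (map snd (zip xs ys)))) (list_pmf K ys))"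
    using assms by (simp add: basic_transform_def replicate_pmf_bind map_bind_pmf map_pmf_comp
      Let_def msg_def msg_prefix_def)
  also have "\<dots> = bind_pmf (replicate_pmf n M) (\<lambda>ys. map_pmf
        (\<lambda>xs. (msg G (vec_of_list xs) $ i, Trans (msg_prefix G i xs) ys)) (list_pmf K ys))"
    by (intro bind_pmf_cong map_pmf_cong refl) (simp add: length_list_pmf)
  finally show ?thesis .
qed

text \<open>The case of \<open>cond_entropy_bind\<close> in which nothing but \<open>y\<close> is
  observed. The injective renaming \<open>T\<close> covers the original source as well as its
  embedding by \<open>Orig\<close>.\<close>

lemma cond_entropy_source:
  fixes M :: "'y pmf" and K :: "'y \<Rightarrow> 'a::{field,finite} pmf"
  assumes "\<And>b b'. T b = T b' \<Longrightarrow> b = b'"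
  shows "cond_entropy (bind_pmf M (\<lambda>y. map_pmf (\<lambda>x. (x, T y)) (K y)))
    = measure_pmf.expectation M (\<lambda>y. ent (K y)) / ln (real CARD('a))"
proof -
  have "ent (map_pmf (\<lambda>w. (w, ())) (K y)) = ent (K y)" for y
    by (rule ent_map_inj) (simp add: inj_on_def)
  then show ?thesis
    using cond_entropy_bind[of M K "\<lambda>_ y. T y" "\<lambda>x. x" "\<lambda>_. ()"] assms card_field_ge_2[where 'a = 'a]
    by (simp add: map_pmf_const)
qed

lemma cond_entropy_range:
  fixes P :: "('a::{field,finite}, 'y) source"
  shows "0 \<le> cond_entropy P" "cond_entropy P \<le> 1"
proof -
  obtain M K where "P = bind_pmf M (\<lambda>y. map_pmf (\<lambda>x. (x, y)) (K y))"
    using pmf_disintegrate by blast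
  then have H: "cond_entropy P = measure_pmf.expectation M (\<lambda>y. ent (K y)) / ln (real CARD('a))"
    using cond_entropy_source[of "\<lambda>y. y" M K] by simp
  have q: "ln (real CARD('a)) > 0" using card_field_ge_2[where 'a = 'a] by simp
  have le: "ent (K y) \<le> ln (real CARD('a))" for y by (rule ent_le_ln_card) auto
  have "0 \<le> measure_pmf.expectation M (\<lambda>y. ent (K y))"
    by (intro integral_nonneg_AE) (simp add: ent_nonneg)
  then show "0 \<le> cond_entropy P" using q unfolding H by simp
  have "measure_pmf.expectation M (\<lambda>y. ent (K y)) \<le> ln (real CARD('a))"
    using le by (intro measure_pmf.integral_le_const
      measure_pmf.integrable_const_bound[where B = "ln (real CARD('a))"]) (auto simp: ent_nonneg)
  then show "cond_entropy P \<le> 1" using q unfolding H by simp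
qed

lemma ent_list_pmf_le:
  fixes K :: "'y \<Rightarrow> 'a::finite pmf"
  shows "ent (list_pmf K ys) \<le> real (length ys) * ln (real CARD('a))"
proof -
  have "ent (list_pmf K ys) = (\<Sum>y\<leftarrow>ys. ent (K y))" by (rule ent_list_pmf) simp
  also have "\<dots> \<le> (\<Sum>y\<leftarrow>ys. ln (real CARD('a)))"
    by (intro sum_list_mono ent_le_ln_card) auto
  finally show ?thesis by (simp add: sum_list_triv)
qed

lemma finite_list_pmf' [simp]: "finite (set_pmf (list_pmf (K :: 'y \<Rightarrow> 'a::finite pmf) ys))"
  by (rule finite_list_pmf) simp

lemma integrable_replicate_pmf:
  fixes K :: "'y \<Rightarrow> 'a::finite pmf"
  assumes "\<And>ys. length ys = n \<Longrightarrow> \<bar>f ys\<bar> \<le> B"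
  shows "integrable (measure_pmf (replicate_pmf n M)) (f :: _ \<Rightarrow> real)"
  using assms by (intro measure_pmf.integrable_const_bound[where B = B])
    (auto simp: AE_measure_pmf_iff set_replicate_pmf)

lemma integrable_prefix_ent:
  fixes K :: "'y \<Rightarrow> 'a::{field,finite} pmf"
  shows "integrable (measure_pmf (replicate_pmf n M)) (prefix_ent G K k)"
proof (rule integrable_replicate_pmf)
  fix ys :: "'y list" assume ys: "length ys = n"
  have "prefix_ent G K k ys \<le> ent (list_pmf K ys)"
    unfolding prefix_ent_def by (rule ent_map_le) simp
  then show "\<bar>prefix_ent G K k ys\<bar> \<le> real n * ln (real CARD('a))"
    using ent_list_pmf_le[of K ys] ys by (simp add: prefix_ent_def ent_nonneg)
qed

lemma prefix_ent_0 [simp]: "prefix_ent G K 0 ys = 0"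
  unfolding prefix_ent_def msg_prefix_def by (simp add: map_pmf_const)

lemma prefix_ent_all:
  fixes K :: "'y \<Rightarrow> 'a::{field,finite} pmf"
  assumes G: "G \<in> carrier_mat n n" and det: "det G \<noteq> 0" and ys: "length ys = n"
  shows "prefix_ent G K n ys = ent (list_pmf K ys)"
  unfolding prefix_ent_def
proof (rule ent_map_inj, rule inj_onI)
  fix xs xs' assume "xs \<in> set_pmf (list_pmf K ys)" "xs' \<in> set_pmf (list_pmf K ys)"
    "msg_prefix G n xs = msg_prefix G n xs'"
  then show "xs = xs'" using ys by (auto dest: length_list_pmf intro: msg_prefix_inj[OF G det, of xs xs'])
qed

text \<open>Chain rule: message \<open>i\<close> together with the prefix of length \<open>i\<close>
  carries the same information as the prefix of length \<open>Suc i\<close>.\<close>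

lemma cond_entropy_basic_transform:
  fixes G :: "'a::{field,finite} mat" and M :: "('a, 'y) obs pmf" and K :: "('a, 'y) obs \<Rightarrow> 'a pmf"
  assumes G: "G \<in> carrier_mat n n"
  shows "cond_entropy (basic_transform G i (bind_pmf M (\<lambda>y. map_pmf (\<lambda>x. (x, y)) (K y))))
    = measure_pmf.expectation (replicate_pmf n M)
        (\<lambda>ys. prefix_ent G K (Suc i) ys - prefix_ent G K i ys) / ln (real CARD('a))"
proof -
  have "ent (map_pmf (\<lambda>xs. (msg G (vec_of_list xs) $ i, msg_prefix G i xs)) (list_pmf K ys))
      = prefix_ent G K (Suc i) ys" for ys
    unfolding prefix_ent_def by (rule ent_map_cong) (auto simp: msg_prefix_eq_iff less_Suc_eq)
  note eq = this
  have "cond_entropy (bind_pmf (replicate_pmf n M) (\<lambda>ys. map_pmf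
      (\<lambda>xs. (msg G (vec_of_list xs) $ i, Trans (msg_prefix G i xs) ys)) (list_pmf K ys)))
    = measure_pmf.expectation (replicate_pmf n M) (\<lambda>ys.
        ent (map_pmf (\<lambda>xs. (msg G (vec_of_list xs) $ i, msg_prefix G i xs)) (list_pmf K ys))
        - ent (map_pmf (msg_prefix G i) (list_pmf K ys))) / ln (real CARD('a))"
    by (rule cond_entropy_bind) (auto simp: card_field_ge_2)
  then show ?thesis
    unfolding basic_transform_bind[OF G] eq by (simp only: prefix_ent_def)
qed

text \<open>The increments telescope, and the full prefix determines the input, so its entropy is
  that of the input.\<close>

lemma sum_cond_entropy_basic_transform:
  fixes G :: "'a::{field,finite} mat" and M :: "('a, 'y) obs pmf" and K :: "('a, 'y) obs \<Rightarrow> 'a pmf"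
  assumes G: "G \<in> carrier_mat n n" and det: "det G \<noteq> 0" and k: "k \<le> n"
  shows "(\<Sum>i=k..<n. cond_entropy (basic_transform G i (bind_pmf M (\<lambda>y. map_pmf (\<lambda>x. (x, y)) (K y)))))
    = measure_pmf.expectation (replicate_pmf n M)
        (\<lambda>ys. ent (list_pmf K ys) - prefix_ent G K k ys) / ln (real CARD('a))"
proof -
  have "(\<Sum>i=k..<n. cond_entropy (basic_transform G i (bind_pmf M (\<lambda>y. map_pmf (\<lambda>x. (x, y)) (K y)))))
    = (\<Sum>i=k..<n. measure_pmf.expectation (replicate_pmf n M)
        (\<lambda>ys. prefix_ent G K (Suc i) ys - prefix_ent G K i ys)) / ln (real CARD('a))"
    unfolding cond_entropy_basic_transform[OF G] by (simp add: sum_divide_distrib)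
  also have "(\<Sum>i=k..<n. measure_pmf.expectation (replicate_pmf n M)
        (\<lambda>ys. prefix_ent G K (Suc i) ys - prefix_ent G K i ys))
    = measure_pmf.expectation (replicate_pmf n M)
        (\<lambda>ys. \<Sum>i=k..<n. prefix_ent G K (Suc i) ys - prefix_ent G K i ys)"
    by (rule Bochner_Integration.integral_sum[symmetric]) (intro Bochner_Integration.integrable_diff integrable_prefix_ent)
  also have "\<dots> = measure_pmf.expectation (replicate_pmf n M) (\<lambda>ys. prefix_ent G K n ys - prefix_ent G K k ys)"
    by (rule arg_cong[of _ _ "measure_pmf.expectation _"], rule ext, rule sum_Suc_diff'[OF k])
  also have "\<dots> = measure_pmf.expectation (replicate_pmf n M) (\<lambda>ys. ent (list_pmf K ys) - prefix_ent G K k ys)"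
    by (intro integral_cong_AE) (auto simp: AE_measure_pmf_iff set_replicate_pmf prefix_ent_all[OF G det])
  finally show ?thesis .
qed

section \<open>Averages over the observations and the martingale identity\<close>

lemma expectation_replicate_nth:
  assumes "j < n"
  shows "measure_pmf.expectation (replicate_pmf n M) (\<lambda>ys. f (ys ! j)) = measure_pmf.expectation M (f :: _ \<Rightarrow> real)"
proof -
  have "map_pmf (\<lambda>ys. ys ! j) (replicate_pmf n M) = M"
    using assms by (simp add: replicate_pmf_eq_list_pmf list_pmf_nth)
  then show ?thesis by (metis integral_map_pmf)
qed

lemma expectation_replicate_pair:
  assumes "n \<ge> 2"
  shows "measure_pmf.expectation (replicate_pmf n M) (\<lambda>ys. f (ys ! 0) (ys ! 1) :: real)
    = measure_pmf.expectation (pair_pmf M M) (\<lambda>(y, y'). f y y')"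
proof -
  have "map_pmf (\<lambda>ys. (ys ! 0, ys ! 1)) (replicate_pmf n M) = pair_pmf M M"
    using assms list_pmf_nth_pair[of "replicate n ()" "\<lambda>_. M"] by (simp add: replicate_pmf_eq_list_pmf)
  then show ?thesis
    using integral_map_pmf[of "\<lambda>ys. (ys ! 0, ys ! 1)" "replicate_pmf n M" "\<lambda>(y, y'). f y y'"] by simp
qed

lemma expectation_ent_list_pmf:
  fixes K :: "'y \<Rightarrow> 'a::finite pmf"
  shows "measure_pmf.expectation (replicate_pmf n M) (\<lambda>ys. ent (list_pmf K ys))
    = real n * measure_pmf.expectation M (\<lambda>y. ent (K y))"
proof -
  have le: "ent (K y) \<le> ln (real CARD('a))" for y by (rule ent_le_ln_card) auto
  have "measure_pmf.expectation (replicate_pmf n M) (\<lambda>ys. ent (list_pmf K ys))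
      = measure_pmf.expectation (replicate_pmf n M) (\<lambda>ys. \<Sum>j<n. ent (K (ys ! j)))"
    by (intro integral_cong_AE)
      (auto simp: AE_measure_pmf_iff set_replicate_pmf ent_list_pmf sum_list_sum_nth atLeast0LessThan)
  also have "\<dots> = (\<Sum>j<n. measure_pmf.expectation (replicate_pmf n M) (\<lambda>ys. ent (K (ys ! j))))"
    using le by (intro Bochner_Integration.integral_sum integrable_replicate_pmf[where B = "ln (real CARD('a))"])
      (simp add: ent_nonneg)
  also have "\<dots> = real n * measure_pmf.expectation M (\<lambda>y. ent (K y))"
    by (simp add: expectation_replicate_nth[of _ n M "\<lambda>y. ent (K y)"])
  finally show ?thesis .
qed

text \<open>The telescoped sum from \<open>k = 0\<close>: the transform is a bijection and the
  inputs are independent given the observations, so the total is \<open>n\<close> times the entropy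
  of one input.\<close>

lemma cond_entropy_martingale:
  fixes G :: "'a::{field,finite} mat" and P :: "('a, ('a, 'y) obs) source"
  assumes G: "G \<in> carrier_mat n n" and det: "det G \<noteq> 0"
  shows "(\<Sum>i<n. cond_entropy (basic_transform G i P)) = real n * cond_entropy P"
proof -
  obtain M K where P: "P = bind_pmf M (\<lambda>y. map_pmf (\<lambda>x. (x, y)) (K y))"
    using pmf_disintegrate by blast
  have "cond_entropy P = measure_pmf.expectation M (\<lambda>y. ent (K y)) / ln (real CARD('a))"
    unfolding P by (rule cond_entropy_source)
  moreover have "(\<Sum>i<n. cond_entropy (basic_transform G i P))
    = real n * measure_pmf.expectation M (\<lambda>y. ent (K y)) / ln (real CARD('a))"
    using sum_cond_entropy_basic_transform[OF G det, of 0 M K]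
    by (simp add: P expectation_ent_list_pmf atLeast0LessThan)
  ultimately show ?thesis by simp
qed

text \<open>The statistic \<open>\<sigma>\<close> and the prefix together determine the input, and
  \<open>\<zeta> (\<sigma> xs)\<close> is a function of either one. Submodularity with this common
  function bounds the entropy of the messages from \<open>k\<close> on.\<close>

lemma ent_minus_prefix_ent_le:
  fixes K :: "'y \<Rightarrow> 'a::{field,finite} pmf"
  assumes det: "\<And>xs xs'. length xs = n \<Longrightarrow> length xs' = n \<Longrightarrow>
      msg_prefix G k xs = msg_prefix G k xs' \<Longrightarrow> \<sigma> xs = \<sigma> xs' \<Longrightarrow> xs = xs'"
    and \<phi>: "\<And>xs. length xs = n \<Longrightarrow> \<zeta> (\<sigma> xs) = \<phi> (msg_prefix G k xs)"
    and ys: "length ys = n"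
  shows "ent (list_pmf K ys) - prefix_ent G K k ys
    \<le> ent (map_pmf \<sigma> (list_pmf K ys)) - ent (map_pmf \<zeta> (map_pmf \<sigma> (list_pmf K ys)))"
proof -
  have len: "length xs = n" if "xs \<in> set_pmf (list_pmf K ys)" for xs
    using length_list_pmf[OF that] ys by simp
  have "ent (map_pmf (\<lambda>xs. (msg_prefix G k xs, \<sigma> xs)) (list_pmf K ys)) = ent (list_pmf K ys)"
    by (rule ent_map_inj) (auto simp: inj_on_def len intro: det)
  moreover have "ent (map_pmf (\<lambda>xs. (msg_prefix G k xs, \<sigma> xs)) (list_pmf K ys))
      + ent (map_pmf (\<lambda>xs. \<zeta> (\<sigma> xs)) (list_pmf K ys))
    \<le> ent (map_pmf (msg_prefix G k) (list_pmf K ys)) + ent (map_pmf \<sigma> (list_pmf K ys))"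
    by (rule ent_submodular[where \<phi> = \<phi> and \<psi> = \<zeta>]) (auto simp: len \<phi>)
  ultimately show ?thesis by (simp add: prefix_ent_def map_pmf_comp)
qed

section \<open>Entropy of the last one or two messages\<close>

definition diff_pmf :: "'a::{field,finite} \<Rightarrow> 'a pmf \<Rightarrow> 'a pmf \<Rightarrow> 'a pmf" where
  "diff_pmf \<beta> P Q = map_pmf (\<lambda>(x, y). x - \<beta> * y) (pair_pmf P Q)"

text \<open>\<open>h\<close> is injective once the second component is known, so together they carry
  the entropy \<open>ent p + ent q\<close>. By subadditivity at least \<open>ent p\<close> of it
  belongs to \<open>h\<close>.\<close>

lemma ent_map_pair_ge:
  assumes fin: "finite (set_pmf p)" "finite (set_pmf q)"
    and inj: "\<And>x x' y. h (x, y) = h (x', y) \<Longrightarrow> x = x'"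
  shows "ent p \<le> ent (map_pmf h (pair_pmf p q))"
proof -
  let ?r = "pair_pmf p q"
  have "ent (map_pmf (\<lambda>w. (h w, snd w)) ?r) + ent (map_pmf (\<lambda>_. ()) ?r) \<le> ent (map_pmf h ?r) + ent (map_pmf snd ?r)"
    using fin by (intro ent_submodular) auto
  moreover have "ent (map_pmf (\<lambda>w. (h w, snd w)) ?r) = ent ?r"
    by (rule ent_map_inj) (auto simp: inj_on_def dest: inj)
  ultimately show ?thesis
    using ent_pair[OF fin] by (simp add: map_pmf_const map_snd_pair_pmf)
qed

lemma ent_diff_pmf_ge: "ent P \<le> ent (diff_pmf \<beta> P Q)"
  unfolding diff_pmf_def by (rule ent_map_pair_ge) auto

text \<open>Two inputs with equal first \<open>k\<close> messages differ by a combination of the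
  rows from \<open>k\<close> on, which is trivial if it has more than
  \<open>CARD('a) - 1 - k\<close> zeros.\<close>

lemma rs_msg_determined:
  fixes \<alpha> :: "'a::{field,finite}"
  assumes prim: "primitive_element \<alpha>" and xs: "length xs = CARD('a)" "length xs' = CARD('a)"
    and pre: "msg_prefix (rs_mat \<alpha>) k xs = msg_prefix (rs_mat \<alpha>) k xs'"
    and T: "T \<subseteq> {..<CARD('a)}" "card T > CARD('a) - 1 - k" "\<And>j. j \<in> T \<Longrightarrow> xs ! j = xs' ! j"
  shows "xs = xs'"
proof (rule msg_prefix_inj[OF rs_mat_carrier(1) det_rs_mat[OF prim] xs])
  let ?q = "CARD('a)" and ?u = "msg (rs_mat \<alpha>) (vec_of_list xs)" and ?u' = "msg (rs_mat \<alpha>) (vec_of_list xs')"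
  define c where "c i = ?u $ i - ?u' $ i" for i
  have c0: "c i = 0" if "i < k" for i using pre that by (simp add: msg_prefix_eq_iff c_def)
  note nth = nth_eq_sum_msg[OF rs_mat_carrier(1) det_rs_mat[OF prim]]
  have zero: "(\<Sum>i=k..<?q. c i * rs_mat \<alpha> $$ (i, j)) = 0" if j: "j \<in> T" for j
  proof -
    have "(\<Sum>i=k..<?q. c i * rs_mat \<alpha> $$ (i, j)) = (\<Sum>i<?q. c i * rs_mat \<alpha> $$ (i, j))"
      by (intro sum.mono_neutral_left) (auto simp: c0)
    also have "\<dots> = xs ! j - xs' ! j"
      using j T(1) by (subst (1 2) nth) (auto simp: xs c_def left_diff_distrib sum_subtractf)
    finally show ?thesis using T(3)[OF j] by simp
  qed
  have "\<not> (\<exists>i\<in>{k..<?q}. c i \<noteq> 0)"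
  proof
    assume "\<exists>i\<in>{k..<?q}. c i \<noteq> 0"
    from rs_mat_card_zeros[OF prim this]
    have "card {j. j < ?q \<and> (\<Sum>i=k..<?q. c i * rs_mat \<alpha> $$ (i, j)) = 0} \<le> ?q - 1 - k" .
    moreover have "card T \<le> card {j. j < ?q \<and> (\<Sum>i=k..<?q. c i * rs_mat \<alpha> $$ (i, j)) = 0}"
      using zero T(1) by (intro card_mono) auto
    ultimately show False using T(2) by simp
  qed
  then have "c i = 0" if "i < ?q" for i using c0 that by (cases "i < k") auto
  then show "msg_prefix (rs_mat \<alpha>) ?q xs = msg_prefix (rs_mat \<alpha>) ?q xs'"
    by (simp add: msg_prefix_eq_iff c_def)
qed

text \<open>The functional \<open>c\<close> is orthogonal to the rows from \<open>k\<close> on, so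
  the messages belonging to them drop out of the expansion.\<close>

lemma rs_lincomb_msg_prefix:
  fixes \<alpha> :: "'a::{field,finite}"
  assumes prim: "primitive_element \<alpha>" and k: "k \<le> CARD('a)"
    and d: "\<And>i. k \<le> i \<Longrightarrow> i < CARD('a) \<Longrightarrow> (\<Sum>j<CARD('a). c j * rs_mat \<alpha> $$ (i, j)) = 0"
    and xs: "length xs = CARD('a)"
  shows "(\<Sum>j<CARD('a). c j * xs ! j)
    = (\<Sum>i<k. msg_prefix (rs_mat \<alpha>) k xs ! i * (\<Sum>j<CARD('a). c j * rs_mat \<alpha> $$ (i, j)))"
proof -
  let ?q = "CARD('a)" and ?u = "msg (rs_mat \<alpha>) (vec_of_list xs)"
  have "(\<Sum>j<?q. c j * xs ! j) = (\<Sum>j<?q. \<Sum>i<?q. ?u $ i * (c j * rs_mat \<alpha> $$ (i, j)))"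
    by (intro sum.cong refl, subst nth_eq_sum_msg[OF rs_mat_carrier(1) det_rs_mat[OF prim] xs])
      (auto simp: sum_distrib_left mult_ac)
  also have "\<dots> = (\<Sum>i<?q. ?u $ i * (\<Sum>j<?q. c j * rs_mat \<alpha> $$ (i, j)))"
    by (subst sum.swap) (simp add: sum_distrib_left)
  also have "\<dots> = (\<Sum>i<k. ?u $ i * (\<Sum>j<?q. c j * rs_mat \<alpha> $$ (i, j)))"
    using k d by (intro sum.mono_neutral_right) auto
  finally show ?thesis by (simp add: msg_prefix_def)
qed

lemma sum_three_coeffs:
  fixes f :: "nat \<Rightarrow> 'a::comm_ring_1"
  assumes "2 \<le> l" "l < n"
  shows "(\<Sum>j<n. (if j = 0 then a else if j = 1 then b else if j = l then c else 0) * f j)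
    = a * f 0 + b * f 1 + c * f l"
proof -
  have "(\<Sum>j<n. (if j = 0 then a else if j = 1 then b else if j = l then c else 0) * f j)
    = (\<Sum>j\<in>{0, 1, l}. (if j = 0 then a else if j = 1 then b else if j = l then c else 0) * f j)"
    using assms by (intro sum.mono_neutral_right) auto
  also have "\<dots> = a * f 0 + b * f 1 + c * f l" using assms by simp
  finally show ?thesis .
qed

lemma sum_two_coeffs:
  fixes f :: "nat \<Rightarrow> 'a::comm_ring_1"
  assumes "2 \<le> n"
  shows "(\<Sum>j<n. (if j = 0 then a else if j = 1 then b else 0) * f j) = a * f 0 + b * f 1"
proof -
  have "(\<Sum>j<n. (if j = 0 then a else if j = 1 then b else 0) * f j)
    = (\<Sum>j\<in>{0, 1}. (if j = 0 then a else if j = 1 then b else 0) * f j)"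
    using assms by (intro sum.mono_neutral_right) auto
  also have "\<dots> = a * f 0 + b * f 1" by simp
  finally show ?thesis .
qed

text \<open>The last row is constantly 1, so the difference of the first two inputs does not involve
  the last message and is a function of the prefix.\<close>

lemma ent_tail_last:
  fixes \<alpha> :: "'a::{field,finite}" and K :: "'y \<Rightarrow> 'a pmf"
  assumes prim: "primitive_element \<alpha>" and ys: "length ys = CARD('a)"
  shows "ent (list_pmf K ys) - prefix_ent (rs_mat \<alpha>) K (CARD('a) - 1) ys
    \<le> ent (K (ys ! 0)) + ent (K (ys ! 1)) - ent (diff_pmf 1 (K (ys ! 0)) (K (ys ! 1)))"
proof -
  let ?q = "CARD('a)"
  have q: "?q \<ge> 2" by (rule card_field_ge_2)
  define c :: "nat \<Rightarrow> 'a" where "c j = (if j = 0 then 1 else if j = 1 then - 1 else 0)" for j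
  define \<sigma> :: "'a list \<Rightarrow> 'a \<times> 'a" where "\<sigma> xs = (xs ! 0, xs ! 1)" for xs
  define \<zeta> :: "'a \<times> 'a \<Rightarrow> 'a" where "\<zeta> = (\<lambda>(x, y). x - 1 * y)"
  have "ent (list_pmf K ys) - prefix_ent (rs_mat \<alpha>) K (?q - 1) ys
    \<le> ent (map_pmf \<sigma> (list_pmf K ys)) - ent (map_pmf \<zeta> (map_pmf \<sigma> (list_pmf K ys)))"
  proof (rule ent_minus_prefix_ent_le[OF _ _ ys])
    fix xs xs' :: "'a list"
    assume "length xs = ?q" "length xs' = ?q" "msg_prefix (rs_mat \<alpha>) (?q - 1) xs = msg_prefix (rs_mat \<alpha>) (?q - 1) xs'"
      "\<sigma> xs = \<sigma> xs'"
    then show "xs = xs'"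
      using q by (intro rs_msg_determined[OF prim, of xs xs' "?q - 1" "{0, 1}"]) (auto simp: \<sigma>_def)
  next
    fix xs :: "'a list" assume xs: "length xs = ?q"
    have zero: "(\<Sum>j<?q. c j * rs_mat \<alpha> $$ (i, j)) = 0" if "?q - 1 \<le> i" "i < ?q" for i
    proof -
      have "i = ?q - 1" using that by simp
      then show ?thesis unfolding c_def sum_two_coeffs[OF q] using q rs_mat_last_row[OF prim] by simp
    qed
    have "\<zeta> (\<sigma> xs) = (\<Sum>j<?q. c j * xs ! j)"
      unfolding c_def sum_two_coeffs[OF q] by (simp add: \<sigma>_def \<zeta>_def)
    also have "\<dots> = (\<Sum>i<?q - 1. msg_prefix (rs_mat \<alpha>) (?q - 1) xs ! i * (\<Sum>j<?q. c j * rs_mat \<alpha> $$ (i, j)))"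
      by (rule rs_lincomb_msg_prefix[OF prim _ zero xs]) simp_all
    finally show "\<zeta> (\<sigma> xs) = (\<lambda>us. \<Sum>i<?q - 1. us ! i * (\<Sum>j<?q. c j * rs_mat \<alpha> $$ (i, j)))
        (msg_prefix (rs_mat \<alpha>) (?q - 1) xs)" .
  qed
  also have "map_pmf \<sigma> (list_pmf K ys) = pair_pmf (K (ys ! 0)) (K (ys ! 1))"
    unfolding \<sigma>_def using q ys by (intro list_pmf_nth_pair) simp
  finally show ?thesis by (simp add: ent_pair diff_pmf_def \<zeta>_def)
qed

text \<open>Three coordinates leave room for a functional that kills two rows. In the last row they
  all carry 1; in the row before, columns 0, 1 and the last one carry 1, the inverse of \<alpha>,
  and 0. This forces the ratio \<open>- \<alpha>\<close> between the first two coefficients.\<close>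

lemma ent_tail_two:
  fixes \<alpha> :: "'a::{field,finite}" and K :: "'y \<Rightarrow> 'a pmf"
  assumes prim: "primitive_element \<alpha>" and ys: "length ys = CARD('a)" and q: "CARD('a) \<ge> 3"
  shows "ent (list_pmf K ys) - prefix_ent (rs_mat \<alpha>) K (CARD('a) - 2) ys
    \<le> ent (K (ys ! 0)) + ent (K (ys ! 1)) + ent (K (ys ! (CARD('a) - 1)))
      - ent (diff_pmf \<alpha> (K (ys ! 0)) (K (ys ! 1)))"
proof -
  let ?q = "CARD('a)"
  have q1: "2 \<le> ?q - 1" "?q - 1 < ?q" using q by auto
  \<comment> \<open>orthogonal to the last two rows of the matrix, so that \<open>\<zeta>\<close> depends on the message prefix only\<close>
  define c :: "nat \<Rightarrow> 'a" where
    "c j = (if j = 0 then 1 else if j = 1 then - \<alpha> else if j = ?q - 1 then \<alpha> - 1 else 0)" for j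
  define \<sigma> :: "'a list \<Rightarrow> ('a \<times> 'a) \<times> 'a" where "\<sigma> xs = ((xs ! 0, xs ! 1), xs ! (?q - 1))" for xs
  define \<zeta> :: "('a \<times> 'a) \<times> 'a \<Rightarrow> 'a" where "\<zeta> = (\<lambda>((x, y), z). x - \<alpha> * y + (\<alpha> - 1) * z)"
  have "ent (list_pmf K ys) - prefix_ent (rs_mat \<alpha>) K (?q - 2) ys
    \<le> ent (map_pmf \<sigma> (list_pmf K ys)) - ent (map_pmf \<zeta> (map_pmf \<sigma> (list_pmf K ys)))"
  proof (rule ent_minus_prefix_ent_le[OF _ _ ys])
    fix xs xs' :: "'a list"
    assume "length xs = ?q" "length xs' = ?q" "msg_prefix (rs_mat \<alpha>) (?q - 2) xs = msg_prefix (rs_mat \<alpha>) (?q - 2) xs'"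
      "\<sigma> xs = \<sigma> xs'"
    then show "xs = xs'"
      using q by (intro rs_msg_determined[OF prim, of xs xs' "?q - 2" "{0, 1}"]) (auto simp: \<sigma>_def)
  next
    fix xs :: "'a list" assume xs: "length xs = ?q"
    have zero: "(\<Sum>j<?q. c j * rs_mat \<alpha> $$ (i, j)) = 0" if i: "?q - 2 \<le> i" "i < ?q" for i
    proof -
      consider "i = ?q - 1" | "i = ?q - 2" using i by arith
      then show ?thesis
      proof cases
        case 1
        then show ?thesis
          unfolding c_def sum_three_coeffs[OF q1] using q rs_mat_last_row[OF prim] by simp
      next
        case 2
        have "\<alpha> * \<alpha> ^ (?q - 2) = \<alpha> ^ Suc (?q - 2)" by simp
        also have "Suc (?q - 2) = ?q - 1" using q by simp
        finally have "\<alpha> * \<alpha> ^ (?q - 2) = 1" using primitive_element_power[OF prim] by simp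
        then show ?thesis
          unfolding c_def sum_three_coeffs[OF q1] using q 2 by (simp add: rs_mat_index)
      qed
    qed
    have "\<zeta> (\<sigma> xs) = (\<Sum>j<?q. c j * xs ! j)"
      unfolding c_def sum_three_coeffs[OF q1] by (simp add: \<sigma>_def \<zeta>_def)
    also have "\<dots> = (\<Sum>i<?q - 2. msg_prefix (rs_mat \<alpha>) (?q - 2) xs ! i * (\<Sum>j<?q. c j * rs_mat \<alpha> $$ (i, j)))"
      by (rule rs_lincomb_msg_prefix[OF prim _ zero xs]) simp_all
    finally show "\<zeta> (\<sigma> xs) = (\<lambda>us. \<Sum>i<?q - 2. us ! i * (\<Sum>j<?q. c j * rs_mat \<alpha> $$ (i, j)))
        (msg_prefix (rs_mat \<alpha>) (?q - 2) xs)" .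
  qed
  also have "map_pmf \<sigma> (list_pmf K ys) = pair_pmf (pair_pmf (K (ys ! 0)) (K (ys ! 1))) (K (ys ! (?q - 1)))"
    unfolding \<sigma>_def using q1 ys by (intro list_pmf_nth_triple) auto
  finally have le: "ent (list_pmf K ys) - prefix_ent (rs_mat \<alpha>) K (?q - 2) ys
    \<le> ent (pair_pmf (pair_pmf (K (ys ! 0)) (K (ys ! 1))) (K (ys ! (?q - 1))))
      - ent (map_pmf \<zeta> (pair_pmf (pair_pmf (K (ys ! 0)) (K (ys ! 1))) (K (ys ! (?q - 1)))))" .
  \<comment> \<open>Adding an independent multiple of the last input cannot decrease entropy, so the
    third coordinate may be dropped from \<open>\<zeta>\<close>.\<close>
  have "ent (map_pmf \<zeta> (pair_pmf (pair_pmf (K (ys ! 0)) (K (ys ! 1))) (K (ys ! (?q - 1)))))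
      \<ge> ent (diff_pmf \<alpha> (K (ys ! 0)) (K (ys ! 1)))"
  proof -
    have "ent (diff_pmf \<alpha> (K (ys ! 0)) (K (ys ! 1)))
      \<le> ent (map_pmf (\<lambda>(x, z). x + (\<alpha> - 1) * z) (pair_pmf (diff_pmf \<alpha> (K (ys ! 0)) (K (ys ! 1))) (K (ys ! (?q - 1)))))"
      by (rule ent_map_pair_ge) auto
    also have "map_pmf (\<lambda>(x, z). x + (\<alpha> - 1) * z) (pair_pmf (diff_pmf \<alpha> (K (ys ! 0)) (K (ys ! 1))) (K (ys ! (?q - 1))))
      = map_pmf \<zeta> (pair_pmf (pair_pmf (K (ys ! 0)) (K (ys ! 1))) (K (ys ! (?q - 1))))"
      by (simp add: diff_pmf_def \<zeta>_def pair_map_pmf1 map_pmf_comp case_prod_unfold)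
    finally show ?thesis .
  qed
  then show ?thesis using le by (simp add: ent_pair)
qed

text \<open>Each of the last outputs has entropy at least \<open>cond_entropy P - m\<close>, and the
  tail bounds convert this into an upper bound on the entropy of the difference. The factor 2 comes
  from \<open>\<beta> = \<alpha>\<close>, where two outputs are involved.\<close>

lemma expectation_gap_le:
  fixes \<alpha> \<beta> :: "'a::{field,finite}" and M :: "('a, 'y) obs pmf" and K :: "('a, 'y) obs \<Rightarrow> 'a pmf"
  assumes prim: "primitive_element \<alpha>" and \<beta>: "\<beta> = 1 \<or> \<beta> = \<alpha>"
  defines "P \<equiv> bind_pmf M (\<lambda>y. map_pmf (\<lambda>x. (x, y)) (K y))"
  assumes m: "\<And>i. i < CARD('a) \<Longrightarrow> \<bar>cond_entropy (basic_transform (rs_mat \<alpha>) i P) - cond_entropy P\<bar> \<le> m"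
  shows "measure_pmf.expectation (pair_pmf M M) (\<lambda>(y, y'). ent (diff_pmf \<beta> (K y) (K y')) - ent (K y))
    \<le> 2 * m * ln (real CARD('a))"
proof -
  let ?q = "CARD('a)" and ?L = "ln (real CARD('a))" and ?N = "replicate_pmf CARD('a) M"
  let ?h = "\<lambda>i. cond_entropy (basic_transform (rs_mat \<alpha>) i P)" and ?e = "measure_pmf.expectation M (\<lambda>y. ent (K y))"
  have q: "?q \<ge> 2" by (rule card_field_ge_2)
  have L: "?L > 0" using q by simp
  have le: "ent (R :: 'a pmf) \<le> ?L" for R by (rule ent_le_ln_card) auto
  have abs: "\<bar>ent (R :: 'a pmf)\<bar> \<le> ?L" for R using le[of R] ent_nonneg[of R] by simp
  have H: "cond_entropy P = ?e / ?L"
    unfolding P_def by (rule cond_entropy_source)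
  have tail: "(\<Sum>i=k..<?q. ?h i) * ?L = measure_pmf.expectation ?N (\<lambda>ys. ent (list_pmf K ys) - prefix_ent (rs_mat \<alpha>) K k ys)"
    if "k \<le> ?q" for k
    unfolding P_def sum_cond_entropy_basic_transform[OF rs_mat_carrier(1) det_rs_mat[OF prim] that]
    using L by simp
  have int_tail: "integrable (measure_pmf ?N) (\<lambda>ys. ent (list_pmf K ys) - prefix_ent (rs_mat \<alpha>) K k ys)" for k
  proof (intro Bochner_Integration.integrable_diff integrable_prefix_ent)
    show "integrable (measure_pmf ?N) (\<lambda>ys. ent (list_pmf K ys))"
    proof (rule integrable_replicate_pmf[where B = "real ?q * ?L"])
      fix ys :: "('a, 'y) obs list" assume "length ys = ?q"
      then show "\<bar>ent (list_pmf K ys)\<bar> \<le> real ?q * ?L"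
        using ent_list_pmf_le[of K ys] by (simp add: ent_nonneg)
    qed
  qed
  have int: "integrable (measure_pmf ?N) (\<lambda>ys. ent (R ys :: 'a pmf))" for R
    by (rule integrable_replicate_pmf[where B = ?L]) (rule abs)
  have nth: "measure_pmf.expectation ?N (\<lambda>ys. ent (K (ys ! j))) = ?e" if "j < ?q" for j
    using expectation_replicate_nth[OF that, of M "\<lambda>y. ent (K y)"] .
  have pair: "measure_pmf.expectation (pair_pmf M M) (\<lambda>(y, y'). ent (diff_pmf \<beta> (K y) (K y')) - ent (K y))
    = measure_pmf.expectation ?N (\<lambda>ys. ent (diff_pmf \<beta> (K (ys ! 0)) (K (ys ! 1)))) - ?e"
    unfolding expectation_replicate_pair[OF q, symmetric]
    using q by (subst Bochner_Integration.integral_diff[OF int int]) (simp add: nth)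
  have hm: "cond_entropy P - ?h i \<le> m" if "i < ?q" for i
    using m[OF that] by simp
  have m0: "m \<ge> 0" using m[of 0] q by (meson abs_ge_zero order_trans zero_less_card_finite)
  show ?thesis
  proof (cases "\<beta> = 1")
    case True
    have "?h (?q - 1) * ?L = (\<Sum>i=?q - 1..<?q. ?h i) * ?L"
      using q by (subst sum.atLeast_Suc_lessThan) auto
    also have "\<dots> \<le> measure_pmf.expectation ?N (\<lambda>ys. ent (K (ys ! 0)) + ent (K (ys ! 1))
        - ent (diff_pmf \<beta> (K (ys ! 0)) (K (ys ! 1))))"
      unfolding tail[of "?q - 1", OF diff_le_self]
      by (intro integral_mono_AE int_tail Bochner_Integration.integrable_diff Bochner_Integration.integrable_add int)
        (use ent_tail_last[OF prim] True in \<open>auto simp: AE_measure_pmf_iff set_replicate_pmf\<close>)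
    also have "\<dots> = ?e + ?e - measure_pmf.expectation ?N (\<lambda>ys. ent (diff_pmf \<beta> (K (ys ! 0)) (K (ys ! 1))))"
      using q by (simp add: int nth)
    finally have "measure_pmf.expectation (pair_pmf M M) (\<lambda>(y, y'). ent (diff_pmf \<beta> (K y) (K y')) - ent (K y))
      \<le> (cond_entropy P - ?h (?q - 1)) * ?L"
      unfolding pair H using L by (simp add: left_diff_distrib)
    also have "\<dots> \<le> m * ?L" using hm[of "?q - 1"] L by (intro mult_right_mono) auto
    finally show ?thesis using mult_nonneg_nonneg[OF m0 less_imp_le[OF L]] by (simp add: mult.assoc)
  next
    case False
    then have \<beta>: "\<beta> = \<alpha>" using \<beta> by simp
    \<comment> \<open>Over the field with two elements \<alpha> is 1, which is the case already
      treated.\<close>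
    have q3: "?q \<ge> 3"
    proof (rule ccontr)
      assume "\<not> ?thesis"
      then have "?q - 1 = 1" using q by simp
      then have "\<alpha> = 1" using primitive_element_power[OF prim] by simp
      then show False using False \<beta> by simp
    qed
    have "(?h (?q - 2) + ?h (?q - 1)) * ?L = (\<Sum>i=?q - 2..<?q. ?h i) * ?L"
    proof -
      have "{?q - 2..<?q} = {?q - 2, ?q - 1}" using q3 by auto
      moreover have "?q - 2 \<noteq> ?q - 1" using q3 by simp
      ultimately show ?thesis by simp
    qed
    also have "\<dots> \<le> measure_pmf.expectation ?N (\<lambda>ys. ent (K (ys ! 0)) + ent (K (ys ! 1)) + ent (K (ys ! (?q - 1)))
        - ent (diff_pmf \<beta> (K (ys ! 0)) (K (ys ! 1))))"
      unfolding tail[of "?q - 2", OF diff_le_self] \<beta>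
      by (intro integral_mono_AE int_tail Bochner_Integration.integrable_diff Bochner_Integration.integrable_add int)
        (use ent_tail_two[OF prim _ q3] in \<open>auto simp: AE_measure_pmf_iff set_replicate_pmf\<close>)
    also have "\<dots> = ?e + ?e + ?e - measure_pmf.expectation ?N (\<lambda>ys. ent (diff_pmf \<beta> (K (ys ! 0)) (K (ys ! 1))))"
      using q by (simp add: int nth)
    finally have "measure_pmf.expectation (pair_pmf M M) (\<lambda>(y, y'). ent (diff_pmf \<beta> (K y) (K y')) - ent (K y))
      \<le> ((cond_entropy P - ?h (?q - 2)) + (cond_entropy P - ?h (?q - 1))) * ?L"
      unfolding pair H using L by (simp add: left_diff_distrib distrib_right)
    also have "\<dots> \<le> (m + m) * ?L" using hm[of "?q - 1"] hm[of "?q - 2"] L by (intro mult_right_mono add_mono) auto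
    finally show ?thesis by simp
  qed
qed

section \<open>Single-step polarization\<close>

lemma ent_finite:
  fixes P :: "'a::finite pmf"
  shows "ent P = - (\<Sum>x\<in>UNIV. pmf P x * ln (pmf P x))"
proof -
  have "(\<Sum>x\<in>set_pmf P. pmf P x * ln (pmf P x)) = (\<Sum>x\<in>UNIV. pmf P x * ln (pmf P x))"
    by (rule sum.mono_neutral_left) (auto simp: set_pmf_iff)
  then show ?thesis by (simp add: ent_def)
qed

lemma pmf_diff_pmf:
  "pmf (diff_pmf \<beta> P Q) d = (\<Sum>b\<in>UNIV. pmf Q b * pmf P (d + \<beta> * b))"
proof -
  have "diff_pmf \<beta> P Q = bind_pmf Q (\<lambda>b. map_pmf (\<lambda>x. x - \<beta> * b) P)"
    by (simp add: diff_pmf_def pair_pmf_def map_bind_pmf map_pmf_def bind_assoc_pmf bind_return_pmf)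
      (rule bind_commute_pmf)
  moreover have "pmf (map_pmf (\<lambda>x. x - \<beta> * b) P) d = pmf P (d + \<beta> * b)" for b
    using pmf_map_inj'[of "\<lambda>x. x - \<beta> * b" P "d + \<beta> * b"] by (simp add: inj_on_def)
  ultimately show ?thesis
    by (simp add: pmf_bind) (subst integral_measure_pmf_real[of UNIV], auto simp: mult.commute)
qed

lemma bij_add_right: "bij_betw (\<lambda>x. x + c) UNIV (UNIV :: 'a::group_add set)"
  by (rule bij_betwI[of _ _ _ "\<lambda>x. x - c"]) auto

text \<open>The law of the difference is the mixture of translates of \<open>P\<close> with weights
  from \<open>Q\<close>. The entropy gap is the weighted sum of the divergences of the translates
  from the mixture; if it vanishes, all translates of positive weight equal the mixture and hence
  each other.\<close>

lemma ent_diff_pmf_eq_imp_stable: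
  fixes P Q :: "'a::{field,finite} pmf"
  assumes eq: "ent (diff_pmf \<beta> P Q) = ent P"
    and b: "b \<in> set_pmf Q" "b' \<in> set_pmf Q"
  shows "pmf P (x + \<beta> * (b - b')) = pmf P x"
proof -
  define R where "R = diff_pmf \<beta> P Q"
  \<comment> \<open>Divergence terms, completed by a correction of total sum 0 that makes every
    single term nonnegative.\<close>
  define t where "t b d = pmf Q b * (pmf P (d + \<beta> * b) * (ln (pmf P (d + \<beta> * b)) - ln (pmf R d))
      - pmf P (d + \<beta> * b) + pmf R d)" for b d
  have R: "pmf R d = (\<Sum>b\<in>UNIV. pmf Q b * pmf P (d + \<beta> * b))" for d
    by (simp add: R_def pmf_diff_pmf)
  have Rpos: "pmf R d > 0" if "pmf Q b > 0" "pmf P (d + \<beta> * b) > 0" for b d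
  proof -
    have "pmf Q b * pmf P (d + \<beta> * b) \<le> pmf R d"
      unfolding R by (rule member_le_sum) auto
    then show ?thesis using that by (meson less_le_trans mult_pos_pos)
  qed
  have shift: "(\<Sum>d\<in>UNIV. f (d + \<beta> * b)) = (\<Sum>d\<in>UNIV. f d)" for f :: "'a \<Rightarrow> real" and b
    by (rule sum.reindex_bij_betw[OF bij_add_right])
  have one: "(\<Sum>x\<in>UNIV. pmf p x) = 1" for p :: "'a pmf" by (rule sum_pmf_eq_1) auto
  have t0: "t b d \<ge> 0" for b d
  proof (cases "pmf Q b = 0 \<or> pmf P (d + \<beta> * b) = 0")
    case True
    then show ?thesis by (auto simp: t_def)
  next
    case False
    then have pos: "pmf Q b > 0" "pmf P (d + \<beta> * b) > 0" by (auto simp: pmf_nonneg less_le)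
    have "pmf P (d + \<beta> * b) * (1 - 1 / (pmf P (d + \<beta> * b) / pmf R d))
      \<le> pmf P (d + \<beta> * b) * ln (pmf P (d + \<beta> * b) / pmf R d)"
      using pos Rpos[OF pos] by (intro mult_left_mono ln_ge_one_minus_inverse) auto
    then have "pmf P (d + \<beta> * b) - pmf R d \<le> pmf P (d + \<beta> * b) * (ln (pmf P (d + \<beta> * b)) - ln (pmf R d))"
      using pos Rpos[OF pos] by (simp add: right_diff_distrib ln_div)
    then show ?thesis using pos by (simp add: t_def)
  qed
  have "(\<Sum>b\<in>UNIV. \<Sum>d\<in>UNIV. t b d) = (\<Sum>b\<in>UNIV. \<Sum>d\<in>UNIV. pmf Q b * (pmf P (d + \<beta> * b) * ln (pmf P (d + \<beta> * b))))
      - (\<Sum>b\<in>UNIV. \<Sum>d\<in>UNIV. pmf Q b * pmf P (d + \<beta> * b) * ln (pmf R d))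
      - (\<Sum>b\<in>UNIV. \<Sum>d\<in>UNIV. pmf Q b * pmf P (d + \<beta> * b))
      + (\<Sum>b\<in>UNIV. \<Sum>d\<in>UNIV. pmf Q b * pmf R d)"
    by (simp add: t_def algebra_simps sum.distrib sum_subtractf)
  also have "(\<Sum>b\<in>UNIV. \<Sum>d\<in>UNIV. pmf Q b * (pmf P (d + \<beta> * b) * ln (pmf P (d + \<beta> * b)))) = - ent P"
    unfolding sum_distrib_left[symmetric] shift[of "\<lambda>x. pmf P x * ln (pmf P x)"]
    by (simp add: sum_distrib_right[symmetric] one ent_finite)
  also have "(\<Sum>b\<in>UNIV. \<Sum>d\<in>UNIV. pmf Q b * pmf P (d + \<beta> * b) * ln (pmf R d)) = - ent R"
    by (subst sum.swap) (simp add: sum_distrib_right[symmetric] R[symmetric] ent_finite)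
  also have "(\<Sum>b\<in>UNIV. \<Sum>d\<in>UNIV. pmf Q b * pmf P (d + \<beta> * b)) = 1"
    unfolding sum_distrib_left[symmetric] shift by (simp add: one)
  also have "(\<Sum>b\<in>UNIV. \<Sum>d\<in>UNIV. pmf Q b * pmf R d) = 1"
    by (simp add: sum_distrib_left[symmetric] one)
  finally have "(\<Sum>b\<in>UNIV. \<Sum>d\<in>UNIV. t b d) = 0" using eq by (simp add: R_def)
  then have tz: "t b d = 0" for b d
    using t0 by (simp add: sum_nonneg_eq_0_iff sum_nonneg)
  have PR: "pmf P (d + \<beta> * b) = pmf R d" if "b \<in> set_pmf Q" for b d
  proof -
    have Q: "pmf Q b > 0" using that by (rule pmf_positive)
    then have z: "pmf P (d + \<beta> * b) * (ln (pmf P (d + \<beta> * b)) - ln (pmf R d)) - pmf P (d + \<beta> * b) + pmf R d = 0"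
      using tz[of b d] by (simp add: t_def)
    show ?thesis
    proof (cases "pmf P (d + \<beta> * b) = 0")
      case True
      then show ?thesis using z by simp
    next
      case False
      then have P: "pmf P (d + \<beta> * b) > 0" by (simp add: pmf_nonneg less_le)
      note Rd = Rpos[OF Q P]
      \<comment> \<open>A vanishing term is the equality case of
        \<open>ln x \<le> x - 1\<close>.\<close>
      have "ln (pmf R d / pmf P (d + \<beta> * b)) = pmf R d / pmf P (d + \<beta> * b) - 1"
        using z P Rd by (simp add: ln_div field_simps)
      then have "pmf R d / pmf P (d + \<beta> * b) = 1" using P Rd by (intro ln_eq_minus_one) auto
      then show ?thesis using P by simp
    qed
  qed
  have "pmf P (x + \<beta> * (b - b')) = pmf P ((x - \<beta> * b') + \<beta> * b)" by (simp add: algebra_simps)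
  also have "\<dots> = pmf P ((x - \<beta> * b') + \<beta> * b')" by (simp only: PR[OF b(1)] PR[OF b(2)])
  finally show ?thesis by simp
qed

text \<open>If both gaps vanish, the differences of the support of \<^term>\<open>P\<close> are stabilisers of \<^term>\<open>Q\<close>,
  hence differences of the support of \<^term>\<open>Q\<close>, and \<^term>\<open>\<alpha>\<close> maps these to stabilisers of \<^term>\<open>P\<close>.
  So the differences of the support of \<^term>\<open>P\<close> are closed under multiplication by \<^term>\<open>\<alpha>\<close>.\<close>

lemma ent_extremal:
  fixes P Q :: "'a::{field,finite} pmf"
  assumes prim: "primitive_element \<alpha>"
    and PQ: "ent (diff_pmf \<alpha> P Q) = ent P" and QP: "ent (diff_pmf 1 Q P) = ent Q"
  shows "ent P = 0 \<or> ent Q = ln (real CARD('a))"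
proof (cases "\<exists>a. set_pmf P = {a}")
  case True
  then show ?thesis by (metis ent_return set_pmf_subset_singleton order_refl)
next
  case False
  define D where "D = {a - a' | a a'. a \<in> set_pmf P \<and> a' \<in> set_pmf P}"
  obtain b where b: "b \<in> set_pmf Q" using set_pmf_not_empty[of Q] by blast
  have stabQ: "pmf Q (x + t) = pmf Q x" if "t \<in> D" for x t
    using that ent_diff_pmf_eq_imp_stable[OF QP] by (auto simp: D_def)
  have mult: "\<alpha> * t \<in> D" if t: "t \<in> D" for t
  proof -
    have "b + t \<in> set_pmf Q" using b stabQ[OF t, of b] by (simp add: set_pmf_iff)
    then have stabP: "pmf P (x + \<alpha> * t) = pmf P x" for x
      using ent_diff_pmf_eq_imp_stable[OF PQ _ b, of "b + t" x] by simp
    obtain a where a: "a \<in> set_pmf P" using set_pmf_not_empty[of P] by blast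
    then have "a + \<alpha> * t \<in> set_pmf P" using stabP[of a] by (simp add: set_pmf_iff)
    then show ?thesis using a unfolding D_def by (intro CollectI exI[of _ "a + \<alpha> * t"] exI[of _ a]) auto
  qed
  obtain a a' where a: "a \<in> set_pmf P" "a' \<in> set_pmf P" "a \<noteq> a'"
    using False set_pmf_not_empty[of P] by blast
  define t where "t = a - a'"
  have t: "t \<in> D" "t \<noteq> 0" using a by (auto simp: t_def D_def)
  have pow: "\<alpha> ^ k * t \<in> D" for k
  proof (induction k)
    case (Suc k)
    show ?case using mult[OF Suc] by (simp add: mult.assoc)
  qed (use t in simp)
  \<comment> \<open>One nonzero difference \<open>t\<close> generates all others, since every
    nonzero quotient \<open>x / t\<close> is a power of \<alpha>. So \<open>Q\<close> is invariant
    under all translations.\<close>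
  have all: "x \<in> D" if "x \<noteq> 0" for x
  proof -
    have "x / t \<noteq> 0" using that t by simp
    then obtain k where "x / t = \<alpha> ^ k" using prim unfolding primitive_element_def by blast
    then have "x = \<alpha> ^ k * t" using t by (simp add: field_simps)
    then show ?thesis using pow by simp
  qed
  have const: "pmf Q x = pmf Q b" for x
    using stabQ[of "x - b" b] all[of "x - b"] by (cases "x = b") auto
  have "1 = (\<Sum>x\<in>UNIV. pmf Q x)" by (rule sum_pmf_eq_1[symmetric]) auto
  also have "\<dots> = (\<Sum>x\<in>(UNIV :: 'a set). pmf Q b)" by (intro sum.cong const refl)
  finally have Qb: "pmf Q b = 1 / real CARD('a)" by (simp add: field_simps)
  have "ent Q = - (\<Sum>x\<in>(UNIV :: 'a set). pmf Q b * ln (pmf Q b))"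
    unfolding ent_finite by (intro arg_cong[of _ _ uminus] sum.cong refl arg_cong[where f = "\<lambda>t. t * ln t", OF const])
  then show ?thesis by (simp add: Qb ln_div)
qed

section \<open>Uniform bounds by compactness of the simplex\<close>

lemma continuous_on_xlnx: "continuous_on {0..} (\<lambda>x::real. x * ln x)"
proof -
  have "((\<lambda>x::real. x * ln x) \<longlongrightarrow> a * ln a) (at a within {0..})" if "a \<ge> 0" for a
  proof (cases "a = 0")
    case True
    \<comment> \<open>The value \<open>0 * ln 0 = 0\<close> agrees with the limit from the
      right.\<close>
    have "((\<lambda>x::real. x * ln x) \<longlongrightarrow> 0) (at_right 0)" by real_asymp
    then show ?thesis using True by (simp add: at_within_Ici_at_right)
  next
    case False
    then have "isCont (\<lambda>x::real. x * ln x) a" by (intro continuous_intros) auto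
    then show ?thesis by (simp add: isCont_def tendsto_within_subset[of _ _ _ UNIV])
  qed
  then show ?thesis by (auto simp: continuous_on_def)
qed

text \<open>Probability laws are moved to a Euclidean space to have compactness available; the
  qualified name avoids the vectors of the matrix theory.\<close>

type_synonym 'a rvec = "(real, 'a) Finite_Cartesian_Product.vec"

definition pmf_vec :: "'a::finite pmf \<Rightarrow> 'a rvec" where
  "pmf_vec P = vec_lambda (pmf P)"

definition vec_ent :: "'a::finite rvec \<Rightarrow> real" where
  "vec_ent v = - (\<Sum>x\<in>UNIV. vec_nth v x * ln (vec_nth v x))"

definition vec_diff :: "'a::{field,finite} \<Rightarrow> 'a rvec \<Rightarrow> 'a rvec \<Rightarrow> 'a rvec" where
  "vec_diff \<beta> v w = vec_lambda (\<lambda>d. \<Sum>b\<in>UNIV. vec_nth w b * vec_nth v (d + \<beta> * b))"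

definition prob_simplex :: "('a::finite rvec) set" where
  "prob_simplex = {v. (\<forall>x. 0 \<le> vec_nth v x) \<and> (\<Sum>x\<in>UNIV. vec_nth v x) = 1}"

lemma vec_ent_pmf: "vec_ent (pmf_vec P) = ent P"
  by (simp add: vec_ent_def ent_finite pmf_vec_def)

lemma vec_diff_pmf: "vec_diff \<beta> (pmf_vec P) (pmf_vec Q) = pmf_vec (diff_pmf \<beta> P Q)"
  by (simp add: vec_diff_def pmf_diff_pmf pmf_vec_def fun_eq_iff)

lemma prob_simplex_pmf: "pmf_vec P \<in> prob_simplex"
  by (auto simp: prob_simplex_def pmf_vec_def intro!: sum_pmf_eq_1)

lemma prob_simplex_obtain_pmf:
  assumes "v \<in> prob_simplex"
  obtains P where "v = pmf_vec P"
proof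
  have "(\<integral>\<^sup>+x. ennreal (vec_nth v x) \<partial>count_space UNIV) = 1"
    using assms by (simp add: nn_integral_count_space_finite sum_ennreal prob_simplex_def)
  then show "v = pmf_vec (embed_pmf (vec_nth v))"
    using assms by (auto simp: Finite_Cartesian_Product.vec_eq_iff pmf_vec_def prob_simplex_def pmf_embed_pmf)
qed

lemma compact_prob_simplex: "compact (prob_simplex :: ('a::finite rvec) set)"
proof -
  have "closed (prob_simplex :: ('a rvec) set)"
    unfolding prob_simplex_def
    by (intro closed_Collect_conj closed_Collect_all closed_Collect_le closed_Collect_eq continuous_intros)
  moreover have "prob_simplex \<subseteq> cbox 0 (1 :: 'a rvec)"
  proof
    fix v :: "'a rvec" assume v: "v \<in> prob_simplex"
    have "vec_nth v x \<le> (\<Sum>x\<in>UNIV. vec_nth v x)" for x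
      using v by (intro member_le_sum) (auto simp: prob_simplex_def)
    then show "v \<in> cbox 0 1" using v by (auto simp: mem_box_cart prob_simplex_def)
  qed
  ultimately show ?thesis
    by (metis compact_Int_closed compact_cbox inf.absorb_iff2)
qed

lemma continuous_on_vec_ent: "continuous_on {v. \<forall>x. 0 \<le> vec_nth v x} (vec_ent :: 'a::finite rvec \<Rightarrow> real)"
  unfolding vec_ent_def
  by (intro continuous_on_minus continuous_on_sum continuous_on_compose2[OF continuous_on_xlnx] continuous_intros) auto

text \<open>On the compact set \<open>S\<close> of pairs whose product is at least \<eta>, the sum
  \<open>g\<close> of the two gaps is continuous and, by \<open>ent_extremal\<close>, positive. So
  it is at least some \<open>c > 0\<close> there. The product never exceeds \<open>?L * ?L\<close>,
  hence \<open>C = ?L * ?L / c\<close> suffices.\<close>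

lemma ent_product_le:
  fixes \<alpha> :: "'a::{field,finite}"
  assumes prim: "primitive_element \<alpha>" and \<eta>: "\<eta> > 0"
  shows "\<exists>C\<ge>0. \<forall>P Q :: 'a pmf. ent P * (ln (real CARD('a)) - ent Q)
    \<le> \<eta> + C * ((ent (diff_pmf \<alpha> P Q) - ent P) + (ent (diff_pmf 1 Q P) - ent Q))"
proof -
  let ?L = "ln (real CARD('a))"
  define g :: "'a rvec \<times> 'a rvec \<Rightarrow> real" where "g = (\<lambda>(v, w).
    (vec_ent (vec_diff \<alpha> v w) - vec_ent v) + (vec_ent (vec_diff 1 w v) - vec_ent w))"
  define f :: "'a rvec \<times> 'a rvec \<Rightarrow> real" where "f = (\<lambda>(v, w). vec_ent v * (?L - vec_ent w))"
  define S where "S = {z \<in> prob_simplex \<times> prob_simplex. \<eta> \<le> f z}"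
  have le: "ent (R :: 'a pmf) \<le> ?L" for R by (rule ent_le_ln_card) auto
  have fP: "f (pmf_vec P, pmf_vec Q) = ent P * (?L - ent Q)" for P Q
    by (simp add: f_def vec_ent_pmf)
  have gP: "g (pmf_vec P, pmf_vec Q) = (ent (diff_pmf \<alpha> P Q) - ent P) + (ent (diff_pmf 1 Q P) - ent Q)" for P Q
    by (simp add: g_def vec_ent_pmf vec_diff_pmf)
  have cont_ent: "continuous_on (prob_simplex \<times> prob_simplex) (\<lambda>z. vec_ent (h z))"
    if "continuous_on (prob_simplex \<times> prob_simplex) h" "\<And>z x. z \<in> prob_simplex \<times> prob_simplex \<Longrightarrow> 0 \<le> vec_nth (h z) x"
    for h :: "'a rvec \<times> 'a rvec \<Rightarrow> 'a rvec"
    by (rule continuous_on_compose2[OF continuous_on_vec_ent that(1)]) (use that(2) in auto)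
  have nonneg: "0 \<le> vec_nth v x" if "v \<in> prob_simplex" for v :: "'a rvec" and x
    using that by (simp add: prob_simplex_def)
  have cont_f: "continuous_on (prob_simplex \<times> prob_simplex) f"
    unfolding f_def case_prod_unfold
    by (intro continuous_intros cont_ent) (auto simp: nonneg)
  have cont_g: "continuous_on (prob_simplex \<times> prob_simplex) g"
    unfolding g_def case_prod_unfold
    by (intro continuous_on_add continuous_on_diff cont_ent)
      (auto simp: vec_diff_def nonneg intro!: continuous_intros sum_nonneg)
  have "compact S"
  proof -
    have "closedin (top_of_set (prob_simplex \<times> prob_simplex)) ((prob_simplex \<times> prob_simplex) \<inter> f -` {\<eta>..})"
      by (rule continuous_closedin_preimage[OF cont_f closed_atLeast])
    then have "compact ((prob_simplex \<times> prob_simplex) \<inter> f -` {\<eta>..})"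
      by (rule closedin_compact[OF compact_Times[OF compact_prob_simplex compact_prob_simplex]])
    also have "(prob_simplex \<times> prob_simplex) \<inter> f -` {\<eta>..} = S" by (auto simp: S_def)
    finally show ?thesis .
  qed
  have gpos: "g z > 0" if z: "z \<in> S" for z
  proof -
    obtain v w where vw: "z = (v, w)" "v \<in> prob_simplex" "w \<in> prob_simplex" using z by (auto simp: S_def)
    obtain P where P: "v = pmf_vec P" by (rule prob_simplex_obtain_pmf[OF vw(2)])
    obtain Q where Q: "w = pmf_vec Q" by (rule prob_simplex_obtain_pmf[OF vw(3)])
    have ge: "ent (diff_pmf \<alpha> P Q) - ent P \<ge> 0" "ent (diff_pmf 1 Q P) - ent Q \<ge> 0"
      using ent_diff_pmf_ge by simp_all
    have "ent P * (?L - ent Q) \<noteq> 0" using z \<eta> fP[of P Q] by (auto simp: S_def vw P Q)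
    then have "\<not> (ent (diff_pmf \<alpha> P Q) = ent P \<and> ent (diff_pmf 1 Q P) = ent Q)"
      using ent_extremal[OF prim, of P Q] by auto
    then show ?thesis using ge unfolding vw P Q gP by linarith
  qed
  obtain c where c: "c > 0" "\<And>z. z \<in> S \<Longrightarrow> c \<le> g z"
  proof (cases "S = {}")
    case False
    have "continuous_on S g" by (rule continuous_on_subset[OF cont_g]) (auto simp: S_def)
    then obtain z where "z \<in> S" "\<forall>y\<in>S. g z \<le> g y"
      using continuous_attains_inf[OF \<open>compact S\<close> False] by blast
    then show ?thesis using gpos that[of "g z"] by blast
  \<comment> \<open>If \<open>S\<close> is empty, any positive \<open>c\<close> will do.\<close>
  qed (use that[of 1] in auto)
  show ?thesis
  proof (intro exI[of _ "?L * ?L / c"] conjI allI)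
    show "0 \<le> ?L * ?L / c" using c by simp
    fix P Q :: "'a pmf"
    let ?g = "(ent (diff_pmf \<alpha> P Q) - ent P) + (ent (diff_pmf 1 Q P) - ent Q)"
    have g0: "?g \<ge> 0" using ent_diff_pmf_ge[of P \<alpha> Q] ent_diff_pmf_ge[of Q 1 P] by linarith
    show "ent P * (?L - ent Q) \<le> \<eta> + ?L * ?L / c * ?g"
    proof (cases "ent P * (?L - ent Q) \<le> \<eta>")
      case True
      moreover have "0 \<le> ?L * ?L / c * ?g" using c g0 by simp
      ultimately show ?thesis by linarith
    next
      case False
      then have "(pmf_vec P, pmf_vec Q) \<in> S" using fP[of P Q] by (auto simp: S_def prob_simplex_pmf)
      then have "c \<le> ?g" using c(2) gP by metis
      have "ent P * (?L - ent Q) \<le> ?L * ?L"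
        using le[of P] le[of Q] ent_nonneg[of P] ent_nonneg[of Q] by (intro mult_mono) auto
      also have "\<dots> = ?L * ?L / c * c" using c by simp
      also have "\<dots> \<le> ?L * ?L / c * ?g" using \<open>c \<le> ?g\<close> c by (intro mult_left_mono) auto
      finally show ?thesis using \<eta> by linarith
    qed
  qed
qed

section \<open>Averaging over two independent observations\<close>

lemma expectation_pair_mult:
  fixes f :: "'x \<Rightarrow> real" and g :: "'y \<Rightarrow> real"
  assumes f: "\<And>x. 0 \<le> f x" "\<And>x. f x \<le> B" and g: "\<And>y. 0 \<le> g y" "\<And>y. g y \<le> B"
  shows "measure_pmf.expectation (pair_pmf p q) (\<lambda>(x, y). f x * g y)
    = measure_pmf.expectation p f * measure_pmf.expectation q g"
proof -
  have intf: "integrable (measure_pmf p) f" and intg: "integrable (measure_pmf q) g"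
    using f g by (auto intro!: measure_pmf.integrable_const_bound[where B = B])
  have "(\<integral>\<^sup>+z. ennreal (case z of (x, y) \<Rightarrow> f x * g y) \<partial>pair_pmf p q) = (\<integral>\<^sup>+x. \<integral>\<^sup>+y. ennreal (f x) * ennreal (g y) \<partial>q \<partial>p)"
    using f g by (simp add: nn_integral_pair_pmf' ennreal_mult)
  also have "\<dots> = (\<integral>\<^sup>+x. ennreal (f x) \<partial>p) * (\<integral>\<^sup>+y. ennreal (g y) \<partial>q)"
    by (simp add: nn_integral_cmult nn_integral_multc)
  also have "\<dots> = ennreal (measure_pmf.expectation p f * measure_pmf.expectation q g)"
    using f g intf intg by (simp add: nn_integral_eq_integral ennreal_mult Bochner_Integration.integral_nonneg)
  finally have "(\<integral>\<^sup>+z. ennreal (case z of (x, y) \<Rightarrow> f x * g y) \<partial>pair_pmf p q)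
    = ennreal (measure_pmf.expectation p f * measure_pmf.expectation q g)" .
  then show ?thesis
    using f g by (subst integral_eq_nn_integral) (auto simp: Bochner_Integration.integral_nonneg)
qed

text \<open>\<open>ent_product_le\<close> is applied to the input laws at two independent
  observations and averaged. Independence makes the left side factor into a multiple of
  \<open>H (1 - H)\<close>, while \<open>expectation_gap_le\<close> bounds the averaged
  gaps.\<close>

lemma rs_polarization_step:
  fixes \<alpha> :: "'a::{field,finite}"
  assumes prim: "primitive_element \<alpha>" and \<epsilon>: "\<epsilon> > 0"
  shows "\<exists>C\<ge>0. \<forall>(P :: ('a, ('a, 'y) obs) source) m.
    (\<forall>i<CARD('a). \<bar>cond_entropy (basic_transform (rs_mat \<alpha>) i P) - cond_entropy P\<bar> \<le> m) \<longrightarrow>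
    cond_entropy P * (1 - cond_entropy P) \<le> \<epsilon> + C * m"
proof -
  let ?L = "ln (real CARD('a))"
  have L: "?L > 0" using card_field_ge_2[where 'a = 'a] by simp
  have le: "ent (R :: 'a pmf) \<le> ?L" for R by (rule ent_le_ln_card) auto
  obtain C where C: "C \<ge> 0" "\<And>P Q :: 'a pmf. ent P * (?L - ent Q)
    \<le> \<epsilon> * ?L\<^sup>2 + C * ((ent (diff_pmf \<alpha> P Q) - ent P) + (ent (diff_pmf 1 Q P) - ent Q))"
    using ent_product_le[OF prim, of "\<epsilon> * ?L\<^sup>2"] \<epsilon> L by auto
  show ?thesis
  \<comment> \<open>Each of the two gaps averages to at most \<open>2 * m * ?L\<close>; cancelling
    \<open>?L\<^sup>2\<close> leaves the factor \<open>4 / ?L\<close>.\<close>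
  proof (intro exI[of _ "C * 4 / ?L"] conjI allI impI)
    show "0 \<le> C * 4 / ?L" using C L by simp
    fix P :: "('a, ('a, 'y) obs) source" and m
    assume m: "\<forall>i<CARD('a). \<bar>cond_entropy (basic_transform (rs_mat \<alpha>) i P) - cond_entropy P\<bar> \<le> m"
    obtain M K where P: "P = bind_pmf M (\<lambda>y. map_pmf (\<lambda>x. (x, y)) (K y))"
      using pmf_disintegrate by blast
    let ?H = "cond_entropy P" and ?MM = "pair_pmf M M"
    let ?gap = "\<lambda>\<beta> (y, y'). ent (diff_pmf \<beta> (K y) (K y')) - ent (K y)"
    have H: "measure_pmf.expectation M (\<lambda>y. ent (K y)) = ?H * ?L"
      using cond_entropy_source[of "\<lambda>y. y" M K] L by (simp add: P)
    have int: "integrable (measure_pmf N) (\<lambda>z. ent (R z :: 'a pmf))" for N :: "'n pmf" and R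
      using le by (intro measure_pmf.integrable_const_bound[where B = ?L]) (auto simp: ent_nonneg)
    have "?H * ?L * (?L - ?H * ?L) = measure_pmf.expectation ?MM (\<lambda>(y, y'). ent (K y) * (?L - ent (K y')))"
      using le by (subst expectation_pair_mult[where B = ?L]) (auto simp: ent_nonneg H int)
    also have "\<dots> \<le> measure_pmf.expectation ?MM (\<lambda>z. \<epsilon> * ?L\<^sup>2 + C * (?gap \<alpha> z + ?gap 1 (snd z, fst z)))"
    proof (rule integral_mono)
      show "integrable (measure_pmf ?MM) (\<lambda>(y, y'). ent (K y) * (?L - ent (K y')))"
      proof (rule measure_pmf.integrable_const_bound[where B = "?L * ?L"])
        have "\<bar>ent (K y) * (?L - ent (K y'))\<bar> \<le> ?L * ?L" for y y'
          unfolding abs_mult using le[of "K y"] le[of "K y'"] ent_nonneg[of "K y"] ent_nonneg[of "K y'"]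
          by (intro mult_mono) auto
        then show "AE z in ?MM. norm (case z of (y, y') \<Rightarrow> ent (K y) * (?L - ent (K y'))) \<le> ?L * ?L"
          by (auto simp: case_prod_unfold)
      qed simp
      show "integrable (measure_pmf ?MM) (\<lambda>z. \<epsilon> * ?L\<^sup>2 + C * (?gap \<alpha> z + ?gap 1 (snd z, fst z)))"
        unfolding case_prod_unfold
        by (intro Bochner_Integration.integrable_add Bochner_Integration.integrable_diff integrable_mult_right int) simp
      show "(case z of (y, y') \<Rightarrow> ent (K y) * (?L - ent (K y'))) \<le> \<epsilon> * ?L\<^sup>2 + C * (?gap \<alpha> z + ?gap 1 (snd z, fst z))" for z
        using C(2) by (simp add: case_prod_unfold)
    qed
    also have "\<dots> = \<epsilon> * ?L\<^sup>2 + C * (measure_pmf.expectation ?MM (?gap \<alpha>)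
        + measure_pmf.expectation ?MM (\<lambda>z. ?gap 1 (snd z, fst z)))"
      unfolding case_prod_unfold by (simp add: int)
    \<comment> \<open>The second gap has its arguments exchanged, which the symmetric law
      \<open>?MM\<close> does not notice.\<close>
    also have "measure_pmf.expectation ?MM (\<lambda>z. ?gap 1 (snd z, fst z)) = measure_pmf.expectation ?MM (?gap 1)"
      by (subst (2) pair_commute_pmf) (simp add: case_prod_unfold)
    also have "measure_pmf.expectation ?MM (?gap \<alpha>) + measure_pmf.expectation ?MM (?gap 1) \<le> 2 * m * ?L + 2 * m * ?L"
      using m unfolding P by (intro add_mono expectation_gap_le[OF prim]) auto
    finally have "?H * ?L * (?L - ?H * ?L) \<le> \<epsilon> * ?L\<^sup>2 + C * (2 * m * ?L + 2 * m * ?L)"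
      using C(1) by (simp add: mult_left_mono)
    then have "(?H * (1 - ?H)) * ?L\<^sup>2 \<le> (\<epsilon> + C * 4 / ?L * m) * ?L\<^sup>2"
      using L by (simp add: algebra_simps power2_eq_square)
    then show "?H * (1 - ?H) \<le> \<epsilon> + C * 4 / ?L * m" using L by simp
  qed
qed

section \<open>The entropy process\<close>

lemma prob_space_index_space: "prob_space (index_space q)"
  unfolding index_space_def by (intro prob_space_PiM measure_pmf.prob_space_axioms)

text \<open>With the discrete structure on lists, every function of a prefix becomes measurable. In
  the induction the new coordinate takes only countably many values.\<close>

lemma measurable_prefix:
  "(\<lambda>\<omega>. map \<omega> [0..<n]) \<in> measurable (index_space q) (count_space UNIV)"
proof (induction n)
  case (Suc n)
  have comp: "(\<lambda>\<omega>. \<omega> n) \<in> measurable (index_space q) (count_space UNIV)"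
    unfolding index_space_def by measurable
  have "(\<lambda>\<omega>. map \<omega> [0..<n] @ [j]) \<in> measurable (index_space q) (count_space UNIV)" for j
    by (rule measurable_compose[OF Suc]) simp
  then have "(\<lambda>\<omega>. map \<omega> [0..<n] @ [\<omega> n]) \<in> measurable (index_space q) (count_space UNIV)"
    using measurable_compose_countable[OF _ comp, of "\<lambda>j \<omega>. map \<omega> [0..<n] @ [j]"] by blast
  then show ?case by simp
qed simp

lemma measurable_fun_prefix [measurable]:
  "(\<lambda>\<omega>. F (map \<omega> [0..<n])) \<in> borel_measurable (index_space q)"
  by (rule measurable_compose[OF measurable_prefix]) simp

text \<open>The sequence space is the product of its first coordinate with a copy of itself, and the
  first coordinate is uniform.\<close>

lemma nn_integral_prefix_Cons:
  fixes F :: "nat list \<Rightarrow> ennreal"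
  assumes q: "q > 0"
  shows "(\<integral>\<^sup>+\<omega>. F (map \<omega> [0..<Suc n]) \<partial>index_space q)
    = (\<Sum>i<q. \<integral>\<^sup>+\<omega>. F (i # map \<omega> [0..<n]) \<partial>index_space q) / q"
proof -
  let ?M = "measure_pmf (pmf_of_set {..<q})"
  interpret sequence_space ?M
    by unfold_locales
  have S: "index_space q = S" by (simp add: index_space_def)
  have meas: "(\<lambda>\<omega>. F (map \<omega> [0..<k])) \<in> borel_measurable S" for k
    using measurable_fun_prefix[of F k q] unfolding S .
  have cn: "(\<lambda>(s, \<omega>). case_nat s \<omega>) \<in> measurable (?M \<Otimes>\<^sub>M S) S" by measurable
  have map_Suc: "map (case_nat s \<omega>) [0..<Suc n] = s # map \<omega> [0..<n]" for s \<omega>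
    by (simp add: upt_conv_Cons map_Suc_upt[symmetric] del: upt_Suc map_Suc_upt)
  have "(\<integral>\<^sup>+\<omega>. F (map \<omega> [0..<Suc n]) \<partial>S)
    = (\<integral>\<^sup>+\<omega>. F (map \<omega> [0..<Suc n]) \<partial>distr (?M \<Otimes>\<^sub>M S) S (\<lambda>(s, \<omega>). case_nat s \<omega>))"
    by (simp only: PiM_iter)
  also have "\<dots> = (\<integral>\<^sup>+z. F (map ((\<lambda>(s, \<omega>). case_nat s \<omega>) z) [0..<Suc n]) \<partial>(?M \<Otimes>\<^sub>M S))"
    by (rule nn_integral_distr[OF cn]) (subst measurable_distr_eq1, rule meas)
  also have "\<dots> = (\<integral>\<^sup>+s. \<integral>\<^sup>+\<omega>. F (s # map \<omega> [0..<n]) \<partial>S \<partial>?M)"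
  proof -
    have "(\<lambda>z. F (map ((\<lambda>(s, \<omega>). case_nat s \<omega>) z) [0..<Suc n])) \<in> borel_measurable (?M \<Otimes>\<^sub>M S)"
      by (rule measurable_compose[OF cn meas])
    from nn_integral_fst[OF this] show ?thesis
      by (simp only: prod.case map_Suc)
  qed
  also have "\<dots> = (\<Sum>i<q. \<integral>\<^sup>+\<omega>. F (i # map \<omega> [0..<n]) \<partial>S) / q"
    using q by (subst nn_integral_pmf_of_set) auto
  finally show ?thesis unfolding S .
qed

text \<open>The martingale property averages over the last index, whereas the product decomposition
  splits off the first one; the induction carries the average through the prefix.\<close>

lemma nn_integral_prefix_snoc:
  fixes F :: "nat list \<Rightarrow> ennreal"
  assumes q: "q > 0"
  shows "(\<integral>\<^sup>+\<omega>. F (map \<omega> [0..<Suc n]) \<partial>index_space q)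
    = (\<integral>\<^sup>+\<omega>. (\<Sum>i<q. F (map \<omega> [0..<n] @ [i])) / q \<partial>index_space q)"
proof (induction n arbitrary: F)
  case 0
  interpret prob_space "index_space q" by (rule prob_space_index_space)
  show ?case
    unfolding nn_integral_prefix_Cons[OF q] by (simp add: emeasure_space_1)
next
  case (Suc n)
  have "(\<integral>\<^sup>+\<omega>. F (map \<omega> [0..<Suc (Suc n)]) \<partial>index_space q)
    = (\<Sum>i<q. \<integral>\<^sup>+\<omega>. F (i # map \<omega> [0..<Suc n]) \<partial>index_space q) / q"
    by (rule nn_integral_prefix_Cons[OF q])
  also have "\<dots> = (\<Sum>i<q. \<integral>\<^sup>+\<omega>. (\<Sum>j<q. F (i # map \<omega> [0..<n] @ [j])) / q \<partial>index_space q) / q"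
    by (subst Suc) simp
  also have "\<dots> = (\<integral>\<^sup>+\<omega>. (\<Sum>i<q. F (map \<omega> [0..<Suc n] @ [i])) / q \<partial>index_space q)"
    using nn_integral_prefix_Cons[OF q, where F = "\<lambda>l. (\<Sum>i<q. F (l @ [i])) / q" and n = n] by simp
  finally show ?case .
qed

text \<open>A product below \<open>3 / 16\<close> keeps the sequence out of the interval from
  \<open>1 / 4\<close> to \<open>3 / 4\<close>, and steps shorter than \<open>1 / 2\<close> cannot
  jump across it. On either side the product controls the distance to the nearer endpoint.\<close>

lemma unit_interval_dichotomy:
  fixes x :: "nat \<Rightarrow> real"
  assumes x: "\<And>n. 0 \<le> x n" "\<And>n. x n \<le> 1"
    and prod: "(\<lambda>n. x n * (1 - x n)) \<longlonglongrightarrow> 0" and diff: "(\<lambda>n. x (Suc n) - x n) \<longlonglongrightarrow> 0"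
  shows "x \<longlonglongrightarrow> 0 \<or> x \<longlonglongrightarrow> 1"
proof -
  have "\<forall>\<^sub>F n in sequentially. x n * (1 - x n) < 3 / 16"
    by (rule order_tendstoD(2)[OF prod]) simp
  moreover have "\<forall>\<^sub>F n in sequentially. \<bar>x (Suc n) - x n\<bar> < 1 / 2"
    by (rule order_tendstoD(2)[OF tendsto_rabs_zero[OF diff]]) simp
  ultimately obtain N where N: "\<And>n. n \<ge> N \<Longrightarrow> x n * (1 - x n) < 3 / 16"
    "\<And>n. n \<ge> N \<Longrightarrow> \<bar>x (Suc n) - x n\<bar> < 1 / 2"
    unfolding eventually_sequentially by (metis le_trans nat_le_linear)
  have split: "x n < 1 / 4 \<or> x n > 3 / 4" if "n \<ge> N" for n
  proof (rule ccontr)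
    assume "\<not> ?thesis"
    then have "(x n - 1 / 4) * (3 / 4 - x n) \<ge> 0" by (intro mult_nonneg_nonneg) auto
    then show False using N(1)[OF that] by (simp add: algebra_simps)
  qed
  show ?thesis
  proof (cases "x N < 1 / 4")
    case True
    have small: "x n < 1 / 4" if "n \<ge> N" for n
      using that
    proof (induction n rule: dec_induct)
      case (step n)
      then show ?case using split[of "Suc n"] N(2)[of n] by auto
    qed (rule True)
    have bd: "\<forall>\<^sub>F n in sequentially. x n \<le> 4 / 3 * (x n * (1 - x n))"
      using eventually_ge_at_top[of N]
    proof eventually_elim
      case (elim n)
      have "x n * (3 / 4) \<le> x n * (1 - x n)" using small[OF elim] x by (intro mult_left_mono) auto
      then show ?case by simp
    qed
    have "(\<lambda>n. 4 / 3 * (x n * (1 - x n))) \<longlonglongrightarrow> 0" using tendsto_mult_left[OF prod, of "4 / 3"] by simp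
    from tendsto_sandwich[OF _ bd tendsto_const this] show ?thesis using x by auto
  next
    case False
    have large: "x n > 3 / 4" if "n \<ge> N" for n
      using that
    proof (induction n rule: dec_induct)
      case base
      show ?case using split[of N] False by auto
    next
      case (step n)
      then show ?case using split[of "Suc n"] N(2)[of n] by auto
    qed
    have bd: "\<forall>\<^sub>F n in sequentially. 1 - x n \<le> 4 / 3 * (x n * (1 - x n))"
      using eventually_ge_at_top[of N]
    proof eventually_elim
      case (elim n)
      have "3 / 4 * (1 - x n) \<le> x n * (1 - x n)" using large[OF elim] x by (intro mult_right_mono) auto
      then show ?case by simp
    qed
    have "(\<lambda>n. 4 / 3 * (x n * (1 - x n))) \<longlonglongrightarrow> 0" using tendsto_mult_left[OF prod, of "4 / 3"] by simp
    from tendsto_sandwich[OF _ bd tendsto_const this] have "(\<lambda>n. 1 - x n) \<longlonglongrightarrow> 0" using x by auto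
    from tendsto_diff[OF tendsto_const[of 1] this] show ?thesis by simp
  qed
qed

text \<open>A martingale on the \<open>q\<close>-ary tree whose nodes are index paths. In
  \<open>step\<close> the constant \<open>C\<close> may depend on \<epsilon> but not on the
  node.\<close>

locale tree_martingale =
  fixes q :: nat and h :: "nat list \<Rightarrow> real"
  assumes q: "q > 0"
    and h: "\<And>l. 0 \<le> h l" "\<And>l. h l \<le> 1"
    and mart: "\<And>l. (\<Sum>i<q. h (l @ [i])) = real q * h l"
    and step: "\<And>\<epsilon>. \<epsilon> > 0 \<Longrightarrow> \<exists>C\<ge>0. \<forall>l m. (\<forall>i<q. \<bar>h (l @ [i]) - h l\<bar> \<le> m) \<longrightarrow> h l * (1 - h l) \<le> \<epsilon> + C * m"
begin

text \<open>Conditional variance of the next value: by \<open>mart\<close> the mean over the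
  children is \<open>h l\<close>.\<close>

definition V :: "nat list \<Rightarrow> real" where
  "V l = (\<Sum>i<q. (h (l @ [i]) - h l)\<^sup>2) / real q"

abbreviation "X n \<omega> \<equiv> h (map \<omega> [0..<n])"

sublocale prob_space "index_space q" by (rule prob_space_index_space)

lemma V_nonneg: "0 \<le> V l"
  by (simp add: V_def sum_nonneg)

lemma mean_square: "(\<Sum>i<q. (h (l @ [i]))\<^sup>2) / real q = (h l)\<^sup>2 + V l"
proof -
  have "(\<Sum>i<q. (h (l @ [i]) - h l)\<^sup>2) = (\<Sum>i<q. (h (l @ [i]))\<^sup>2) - 2 * h l * (\<Sum>i<q. h (l @ [i])) + real q * (h l)\<^sup>2"
    by (simp add: power2_diff sum.distrib sum_subtractf sum_distrib_left mult_ac)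
  then have "(\<Sum>i<q. (h (l @ [i]) - h l)\<^sup>2) = (\<Sum>i<q. (h (l @ [i]))\<^sup>2) - real q * (h l)\<^sup>2"
    by (simp add: mart power2_eq_square)
  then show ?thesis using q by (simp add: V_def field_simps)
qed

lemma ennreal_sum_div:
  assumes "\<And>i. 0 \<le> f i"
  shows "(\<Sum>i<q. ennreal (f i)) / of_nat q = ennreal ((\<Sum>i<q. f i) / real q)"
  using assms q by (simp add: sum_ennreal divide_ennreal sum_nonneg ennreal_of_nat_eq_real_of_nat)

lemma nn_integral_X: "(\<integral>\<^sup>+\<omega>. ennreal (X n \<omega>) \<partial>index_space q) = ennreal (h [])"
proof (induction n)
  case 0
  then show ?case by (simp add: emeasure_space_1)
next
  case (Suc n)
  have "(\<integral>\<^sup>+\<omega>. ennreal (X (Suc n) \<omega>) \<partial>index_space q)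
    = (\<integral>\<^sup>+\<omega>. (\<Sum>i<q. ennreal (h (map \<omega> [0..<n] @ [i]))) / of_nat q \<partial>index_space q)"
    by (rule nn_integral_prefix_snoc[OF q, where F = "\<lambda>l. ennreal (h l)"])
  also have "\<dots> = (\<integral>\<^sup>+\<omega>. ennreal (X n \<omega>) \<partial>index_space q)"
    using q by (subst ennreal_sum_div[OF h(1)]) (simp add: mart)
  finally show ?case using Suc by simp
qed

lemma nn_integral_X_square:
  "(\<integral>\<^sup>+\<omega>. ennreal ((X n \<omega>)\<^sup>2) \<partial>index_space q)
    = ennreal ((h [])\<^sup>2) + (\<Sum>k<n. \<integral>\<^sup>+\<omega>. ennreal (V (map \<omega> [0..<k])) \<partial>index_space q)"
proof (induction n)
  case 0
  then show ?case by (simp add: emeasure_space_1)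
next
  case (Suc n)
  have "(\<integral>\<^sup>+\<omega>. ennreal ((X (Suc n) \<omega>)\<^sup>2) \<partial>index_space q)
    = (\<integral>\<^sup>+\<omega>. (\<Sum>i<q. ennreal ((h (map \<omega> [0..<n] @ [i]))\<^sup>2)) / of_nat q \<partial>index_space q)"
    by (rule nn_integral_prefix_snoc[OF q, where F = "\<lambda>l. ennreal ((h l)\<^sup>2)"])
  also have "\<dots> = (\<integral>\<^sup>+\<omega>. ennreal ((X n \<omega>)\<^sup>2) + ennreal (V (map \<omega> [0..<n])) \<partial>index_space q)"
    by (subst ennreal_sum_div) (simp_all add: mean_square V_nonneg)
  also have "\<dots> = (\<integral>\<^sup>+\<omega>. ennreal ((X n \<omega>)\<^sup>2) \<partial>index_space q) + (\<integral>\<^sup>+\<omega>. ennreal (V (map \<omega> [0..<n])) \<partial>index_space q)"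
    by (rule nn_integral_add) (rule measurable_fun_prefix)+
  finally show ?case unfolding Suc by (simp add: add.assoc)
qed

text \<open>The squares never exceed 1, so the expectations of \<open>V\<close> have a sum of at
  most 1. A nonnegative series with finite expectation converges almost everywhere, and its terms
  tend to 0.\<close>

lemma AE_V_tendsto_0: "AE \<omega> in index_space q. (\<lambda>n. V (map \<omega> [0..<n])) \<longlonglongrightarrow> 0"
proof -
  let ?v = "\<lambda>k \<omega>. ennreal (V (map \<omega> [0..<k]))"
  have meas: "?v k \<in> borel_measurable (index_space q)" for k by (rule measurable_fun_prefix)
  have "(\<Sum>k<n. \<integral>\<^sup>+\<omega>. ?v k \<omega> \<partial>index_space q) \<le> 1" for n
  proof -
    have "(\<Sum>k<n. \<integral>\<^sup>+\<omega>. ?v k \<omega> \<partial>index_space q) \<le> (\<integral>\<^sup>+\<omega>. ennreal ((X n \<omega>)\<^sup>2) \<partial>index_space q)"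
      unfolding nn_integral_X_square by simp
    also have "\<dots> \<le> (\<integral>\<^sup>+\<omega>. 1 \<partial>index_space q)"
      using h by (intro nn_integral_mono) (simp add: power_le_one)
    finally show ?thesis by (simp add: emeasure_space_1)
  qed
  then have "(\<Sum>k. \<integral>\<^sup>+\<omega>. ?v k \<omega> \<partial>index_space q) \<le> 1" by (intro suminf_le_const summableI)
  then have "(\<integral>\<^sup>+\<omega>. (\<Sum>k. ?v k \<omega>) \<partial>index_space q) \<le> 1"
    by (subst nn_integral_suminf[OF meas])
  then have "(\<integral>\<^sup>+\<omega>. (\<Sum>k. ?v k \<omega>) \<partial>index_space q) \<noteq> \<infinity>"
    by (auto simp: top_unique)
  then have "AE \<omega> in index_space q. (\<Sum>k. ?v k \<omega>) \<noteq> \<infinity>"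
    by (intro nn_integral_PInf_AE borel_measurable_suminf_order meas)
  then show ?thesis
  proof eventually_elim
    case (elim \<omega>)
    then have "summable (\<lambda>k. V (map \<omega> [0..<k]))"
      by (intro summable_suminf_not_top) (auto simp: V_nonneg)
    then show ?case by (rule summable_LIMSEQ_zero)
  qed
qed

lemma AE_index_less: "AE \<omega> in index_space q. \<forall>n. \<omega> n < q"
  unfolding AE_all_countable
proof
  fix n
  have "AE i in measure_pmf (pmf_of_set {..<q}). i < q"
    using q set_pmf_of_set[of "{..<q}"] by (auto simp: AE_measure_pmf_iff lessThan_empty_iff)
  then show "AE \<omega> in index_space q. \<omega> n < q"
    unfolding index_space_def
    by (intro AE_PiM_component measure_pmf.prob_space_axioms) auto
qed

lemma X_dichotomy:
  assumes V: "(\<lambda>n. V (map \<omega> [0..<n])) \<longlonglongrightarrow> 0" and \<omega>: "\<And>n. \<omega> n < q"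
  shows "(\<lambda>n. X n \<omega>) \<longlonglongrightarrow> 0 \<or> (\<lambda>n. X n \<omega>) \<longlonglongrightarrow> 1"
proof (rule unit_interval_dichotomy)
  \<comment> \<open>Each squared increment is at most the sum of all of them,
    \<open>real q * V\<close>. So \<open>m n\<close> bounds the increments to all children, as
    \<open>step\<close> requires, and not only the one along \<omega>.\<close>
  define m where "m n = sqrt (real q * V (map \<omega> [0..<n]))" for n
  have "m \<longlonglongrightarrow> sqrt (real q * 0)"
    unfolding m_def by (intro tendsto_intros V)
  then have m: "m \<longlonglongrightarrow> 0" by simp
  have le: "\<bar>h (map \<omega> [0..<n] @ [i]) - X n \<omega>\<bar> \<le> m n" if "i < q" for n i
  proof -
    have "(h (map \<omega> [0..<n] @ [i]) - X n \<omega>)\<^sup>2 \<le> (\<Sum>i<q. (h (map \<omega> [0..<n] @ [i]) - X n \<omega>)\<^sup>2)"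
      using that by (intro member_le_sum) auto
    also have "\<dots> = real q * V (map \<omega> [0..<n])" using q by (simp add: V_def)
    finally show ?thesis unfolding m_def by (metis real_sqrt_le_iff real_sqrt_abs)
  qed
  show "(\<lambda>n. X (Suc n) \<omega> - X n \<omega>) \<longlonglongrightarrow> 0"
    by (rule Lim_null_comparison[OF _ m]) (use le[OF \<omega>] in simp)
  show "(\<lambda>n. X n \<omega> * (1 - X n \<omega>)) \<longlonglongrightarrow> 0"
  proof (rule tendstoI)
    fix e :: real assume e: "e > 0"
    \<comment> \<open>\<open>C\<close> is fixed before \<open>n\<close>, so \<open>C * m n\<close>
      still tends to 0.\<close>
    obtain C where C: "C \<ge> 0" "\<And>l m. (\<forall>i<q. \<bar>h (l @ [i]) - h l\<bar> \<le> m) \<Longrightarrow> h l * (1 - h l) \<le> e / 2 + C * m"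
      using step[of "e / 2"] e by auto
    have "(\<lambda>n. e / 2 + C * m n) \<longlonglongrightarrow> e / 2 + C * 0" by (intro tendsto_intros m)
    from order_tendstoD(2)[OF this, of e] e have "\<forall>\<^sub>F n in sequentially. e / 2 + C * m n < e"
      by simp
    then show "\<forall>\<^sub>F n in sequentially. dist (X n \<omega> * (1 - X n \<omega>)) 0 < e"
    proof eventually_elim
      case (elim n)
      have "X n \<omega> * (1 - X n \<omega>) \<le> e / 2 + C * m n" using le by (intro C(2)) auto
      then show ?case using elim h[of "map \<omega> [0..<n]"] by simp
    qed
  qed
qed (use h in auto)

text \<open>The limit takes the values 0 and 1 only, so its expectation is the probability of 1;
  dominated convergence identifies this expectation with the constant mean
  \<open>h []\<close>.\<close>

lemma polarization:
  "\<exists>Hinf \<in> borel_measurable (index_space q).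
    (AE \<omega> in index_space q. (\<lambda>n. X n \<omega>) \<longlonglongrightarrow> Hinf \<omega>) \<and>
    prob {\<omega> \<in> space (index_space q). Hinf \<omega> = 0} = 1 - h [] \<and>
    prob {\<omega> \<in> space (index_space q). Hinf \<omega> = 1} = h []"
proof -
  \<comment> \<open>\<open>lim\<close> is total, so \<open>Hinf\<close> is measurable everywhere;
    where the sequence diverges its value is arbitrary, but this happens on a null set only.\<close>
  define Hinf where "Hinf \<omega> = lim (\<lambda>n. X n \<omega>)" for \<omega>
  have meas [measurable]: "Hinf \<in> borel_measurable (index_space q)"
    unfolding Hinf_def by (intro borel_measurable_lim_metric measurable_fun_prefix)
  have lim: "AE \<omega> in index_space q. (\<lambda>n. X n \<omega>) \<longlonglongrightarrow> Hinf \<omega> \<and> (Hinf \<omega> = 0 \<or> Hinf \<omega> = 1)"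
    using AE_V_tendsto_0 AE_index_less
  proof eventually_elim
    case (elim \<omega>)
    then show ?case using X_dichotomy[of \<omega>] by (auto simp: Hinf_def limI)
  qed
  define A where "A = {\<omega> \<in> space (index_space q). Hinf \<omega> = 1}"
  have A [measurable]: "A \<in> sets (index_space q)" unfolding A_def by measurable
  have "(\<lambda>n. \<integral>\<^sup>+\<omega>. ennreal (X n \<omega>) \<partial>index_space q) \<longlonglongrightarrow> (\<integral>\<^sup>+\<omega>. ennreal (Hinf \<omega>) \<partial>index_space q)"
  proof (rule nn_integral_dominated_convergence[where w = "\<lambda>_. 1"])
    show "AE \<omega> in index_space q. (\<lambda>n. ennreal (X n \<omega>)) \<longlonglongrightarrow> ennreal (Hinf \<omega>)"
      using lim by eventually_elim (auto intro: tendsto_ennrealI)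
    show "(\<lambda>\<omega>. ennreal (X n \<omega>)) \<in> borel_measurable (index_space q)" for n by (rule measurable_fun_prefix)
  qed (use h in \<open>auto simp: emeasure_space_1\<close>)
  then have "ennreal (h []) = (\<integral>\<^sup>+\<omega>. ennreal (Hinf \<omega>) \<partial>index_space q)"
    unfolding nn_integral_X by (rule LIMSEQ_unique[OF tendsto_const])
  also have "\<dots> = (\<integral>\<^sup>+\<omega>. indicator A \<omega> \<partial>index_space q)"
  proof (intro nn_integral_cong_AE)
    show "AE \<omega> in index_space q. ennreal (Hinf \<omega>) = indicator A \<omega>"
      using lim AE_space by eventually_elim (auto simp: A_def)
  qed
  also have "\<dots> = ennreal (prob A)" by (simp add: emeasure_eq_measure)
  finally have probA: "prob A = h []" using h by simp
  have "prob {\<omega> \<in> space (index_space q). Hinf \<omega> = 0} = prob (space (index_space q) - A)"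
    by (intro measure_eq_AE) (use lim in \<open>auto simp: A_def elim: eventually_mono\<close>)
  also have "\<dots> = 1 - h []" using prob_compl[OF A] probA by simp
  finally show ?thesis using probA meas lim unfolding A_def
    by (intro bexI[of _ Hinf]) (auto elim: eventually_mono)
qed

end

lemma polarized_by_rs_mat:
  fixes \<alpha> :: "'a::{field,finite}" and P :: "('a, 'y) source"
  assumes prim: "primitive_element \<alpha>"
  shows "polarized_by (rs_mat \<alpha>) P"
proof -
  define h where "h bs = cond_entropy (path_source (rs_mat \<alpha>) P bs)" for bs
  \<comment> \<open>\<open>fold\<close> applies the last index of the path last, so a step in the
    tree is one basic transform.\<close>
  have snoc: "path_source (rs_mat \<alpha>) P (bs @ [i]) = basic_transform (rs_mat \<alpha>) i (path_source (rs_mat \<alpha>) P bs)" for bs i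
    by (simp add: path_source_def)
  interpret tree_martingale "CARD('a)" h
  proof
    show "(\<Sum>i<CARD('a). h (l @ [i])) = real CARD('a) * h l" for l
      unfolding h_def snoc by (rule cond_entropy_martingale[OF rs_mat_carrier(1) det_rs_mat[OF prim]])
    fix \<epsilon> :: real assume "\<epsilon> > 0"
    from rs_polarization_step[OF prim this, where 'y = 'y]
    show "\<exists>C\<ge>0. \<forall>l m. (\<forall>i<CARD('a). \<bar>h (l @ [i]) - h l\<bar> \<le> m) \<longrightarrow> h l * (1 - h l) \<le> \<epsilon> + C * m"
      unfolding h_def snoc by blast
  qed (simp_all add: h_def cond_entropy_range)
  obtain M K where P: "P = bind_pmf M (\<lambda>y. map_pmf (\<lambda>x. (x, y)) (K y))"
    using pmf_disintegrate by blast
  have "path_source (rs_mat \<alpha>) P [] = bind_pmf M (\<lambda>y. map_pmf (\<lambda>x. (x, Orig y)) (K y))"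
    by (simp add: path_source_def P map_bind_pmf map_pmf_comp)
  \<comment> \<open>Renaming observations by the injective \<open>Orig\<close> preserves conditional
    entropy, so the process starts at \<open>cond_entropy P\<close>.\<close>
  then have h0: "h [] = cond_entropy P"
    using cond_entropy_source[of Orig M K] cond_entropy_source[of "\<lambda>y. y" M K] by (simp add: h_def P)
  show ?thesis
    using polarization unfolding polarized_by_def rs_mat_carrier entropy_process_def h0 h_def[symmetric] .
qed

theorem mainTheorem4:
  fixes p m :: nat
    and \<alpha> :: "'a::{field,finite}"
  assumes "prime p"
    and "m \<ge> 1"
    and "CARD('a) = p ^ m"
    and "primitive_element \<alpha>"
  shows "(\<forall>P :: ('a, 'y) source. polarized_by (rs_mat \<alpha>) P) \<and>
         Ec (rs_mat \<alpha>) = log (real CARD('a)) (fact CARD('a)) / real CARD('a) \<and>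
         Es (rs_mat \<alpha>) = log (real CARD('a)) (fact CARD('a)) / real CARD('a)"
  using assms(4) by (simp add: polarized_by_rs_mat Ec_rs_mat Es_rs_mat)

end
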